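(* Let $m\ge 11$ be an integer, let $b_k=\frac{k+1}{m+1}$ for $k=0,1,\dots,m-1$, and let the real number $b$ be determined by $bm=2\beta$, where $\beta:=\frac{e^{2\pi}\Phi(0)}{4\pi^2}-1\approx 5.059069$. Define $$f_m(t)=\cosh\!\left(\tfrac{9t}{4}\right)+b\sum_{k=0}^{m-1}b_k\cosh\!\left(\tfrac{9kt}{4m}\right),\qquad \Phi_S(m;t)=4\pi^2 f_m(t)\exp(-2\pi\cosh t),$$ and let $\Xi_S(m;2z)=\int_{-\infty}^{\infty}\Phi_S(m;t)e^{izt}\,dt$. Then $$\Xi_S(m;2z)=4\pi^2\big(G_{2\pi}(iz+9/4)+G_{2\pi}(iz-9/4)\big)+4\pi^2 b\sum_{k=0}^{m-1}b_k\big(G_{2\pi}(iz+9k/(4m))+G_{2\pi}(iz-9k/(4m))\big),$$ and moreover: (A) $\Phi_S(m;t)\to\Phi(t)$ as $t\to\infty$ (i.e. $\Phi_S(m;t)-\Phi(t)\to 0$); (B) $\Phi_S(m;0)=\Phi(0)$; (C) the entire function $z\mapsto \Xi_S(m;2z)$ has only real zeros.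
   Context: $\Phi(t)=\sum_{n=1}^{\infty}\left(2\pi^2n^4e^{9t/4}-3\pi n^2e^{5t/4}\right)\exp(-\pi n^2e^{t})$ is the kernel of the Riemann $\Xi$-function (so $\Xi(2z)=\int_{-\infty}^{\infty}\Phi(t)e^{izt}dt$, where $\Xi(z)=\xi(iz+1/2)$ and $\xi(s)=\frac12 s(s-1)\pi^{-s/2}\Gamma(s/2)\zeta(s)$); $\Phi(0)\approx 0.446696$ is its value at $t=0$. For $a>0$ and complex $\nu$, $K_\nu(a)=\int_0^\infty \exp(-a\cosh t)\cosh(\nu t)\,dt$ is the modified Bessel function of the second kind, and $G_a(\nu):=K_\nu(a)$. *)

theory Defs
  imports "HOL-Complex_Analysis.Complex_Analysis"
begin

definition Phi :: "real \<Rightarrow> real" where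
  "Phi t = (\<Sum>j. let n = real (Suc j) in
     (2 * pi ^ 2 * n ^ 4 * exp (9 * t / 4) - 3 * pi * n ^ 2 * exp (5 * t / 4))
       * exp (- pi * n ^ 2 * exp t))"

definition bessel_K :: "complex \<Rightarrow> real \<Rightarrow> complex" where
  "bessel_K \<nu> a = (LINT t:{0..}|lborel.
     complex_of_real (exp (- a * cosh t)) * cosh (\<nu> * complex_of_real t))"

definition G :: "real \<Rightarrow> complex \<Rightarrow> complex" where
  "G a \<nu> = bessel_K \<nu> a"

definition beta_S :: real where
  "beta_S = exp (2 * pi) * Phi 0 / (4 * pi ^ 2) - 1"

definition b_coeff :: "nat \<Rightarrow> nat \<Rightarrow> real" where
  "b_coeff m k = (real k + 1) / (real m + 1)"

text \<open>The functions below take the real number \<open>b\<close> as an explicit argument; it is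
  constrained by \<open>b * m = 2 * beta_S\<close> where they are used.\<close>

definition f_S :: "nat \<Rightarrow> real \<Rightarrow> real \<Rightarrow> real" where
  "f_S m b t = cosh (9 * t / 4)
     + b * (\<Sum>k<m. b_coeff m k * cosh (9 * real k * t / (4 * real m)))"

definition Phi_S :: "nat \<Rightarrow> real \<Rightarrow> real \<Rightarrow> real" where
  "Phi_S m b t = 4 * pi ^ 2 * f_S m b t * exp (- 2 * pi * cosh t)"

text \<open>The normalisation is that of \<open>\<Xi>(2z) = \<integral> \<Phi>(t) e\<^sup>i\<^sup>z\<^sup>t dt\<close>, so the argument \<open>w\<close> stands for \<open>2z\<close>
  and enters the exponential halved.\<close>

definition Xi_S :: "nat \<Rightarrow> real \<Rightarrow> complex \<Rightarrow> complex" where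
  "Xi_S m b w = (LINT t|lborel.
     complex_of_real (Phi_S m b t) * exp (\<i> * (w / 2) * complex_of_real t))"

end

theory Submission
  imports Defs "HOL-Computational_Algebra.Fundamental_Theorem_Algebra"
    "HOL-Probability.Distributions" "HOL-Real_Asymp.Real_Asymp"
begin

text \<open>
  With \<open>\<nu> = i z\<close>, \<open>a = 2 \<pi>\<close>, \<open>\<delta> = 9 / (4 m)\<close> and \<open>P(X) = X\<^sup>m + b \<Sum> b\<^sub>k X\<^sup>k\<close>, the function \<open>\<Xi>\<^sub>S\<close> is a multiple of
  \<open>P(T) K\<^sub>\<nu>(a) + P(T\<^sup>-\<^sup>1) K\<^sub>\<nu>(a)\<close>, where \<open>T\<close> shifts \<open>\<nu>\<close> by \<open>\<delta>\<close>. For fixed \<open>\<nu>\<close> the function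
  \<open>x \<mapsto> K\<^sub>\<nu>(x)\<close> decays at infinity and satisfies a self-adjoint equation with eigenvalue \<open>\<nu>\<^sup>2\<close>, so
  \<open>K\<^sub>\<nu>(a) = 0\<close> forces \<open>\<nu>\<^sup>2 < 0\<close>. As an even entire function of \<open>\<nu>\<close> with
  \<open>log \<bar>K\<^sub>\<nu>(a)\<bar> \<le> o(\<bar>\<nu>\<bar>\<^sup>2)\<close>, it is a locally uniform limit of even real polynomials \<open>p(\<nu>)\<close> with purely
  imaginary zeros, namely the partial products over its zeros. The bound \<open>0 < \<beta> < 6\<close> and \<open>m \<ge> 11\<close> make the
  coefficients of \<open>P\<close> positive and increasing, so by Enestrom--Kakeya the zeros of \<open>P\<close> lie in the open
  unit disc. Hence all zeros of \<open>E = P(T) p\<close> lie in the open left half-plane, so that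
  \<open>\<bar>E(\<nu>)\<bar> > \<bar>cnj (E(- cnj \<nu>))\<bar> = \<bar>P(T\<^sup>-\<^sup>1) p(\<nu>)\<bar>\<close> for \<open>Re \<nu> > 0\<close>. By Hurwitz's theorem the limit has
  no zeros with \<open>Re \<nu> > 0\<close>, and by evenness none with \<open>Re \<nu> < 0\<close>.
\<close>

section \<open>Symmetric shift sums of polynomials\<close>

lemma poly_eq_prod_roots:
  fixes p :: "complex poly"
  obtains r where "\<And>x. poly p x = lead_coeff p * (\<Prod>i<degree p. x - r i)"
    and "\<And>i. i < degree p \<Longrightarrow> poly p (r i) = 0"
proof -
  obtain r where r: "smult (lead_coeff p) (\<Prod>i<degree p. [:-r i, 1:]) = p"
    by (rule complex_poly_decompose')
  have eq: "poly p x = lead_coeff p * (\<Prod>i<degree p. x - r i)" for x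
    by (subst r[symmetric]) (simp add: poly_prod)
  have "poly p (r i) = 0" if "i < degree p" for i
    unfolding eq using that by auto
  with eq show ?thesis by (rule that)
qed

text \<open>In the factorisation over the roots every linear factor is at least as large at
  \<open>y\<close> as at \<open>x\<close>, and the leading coefficient is common to both
  values.\<close>

lemma norm_poly_le:
  fixes p :: "complex poly"
  assumes "\<And>z. poly p z = 0 \<Longrightarrow> norm (x - z) \<le> norm (y - z)"
  shows "norm (poly p x) \<le> norm (poly p y)"
proof -
  obtain r where "\<And>x. poly p x = lead_coeff p * (\<Prod>i<degree p. x - r i)"
    and "\<And>i. i < degree p \<Longrightarrow> poly p (r i) = 0"
    by (rule poly_eq_prod_roots) blast
  then show ?thesis
    by (auto simp: norm_mult simp flip: prod_norm intro!: mult_left_mono prod_mono assms)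
qed

lemma norm_poly_less:
  fixes p :: "complex poly"
  assumes "degree p > 0" and "\<And>z. poly p z = 0 \<Longrightarrow> norm (x - z) < norm (y - z)"
  shows "norm (poly p x) < norm (poly p y)"
proof -
  obtain r where r: "\<And>x. poly p x = lead_coeff p * (\<Prod>i<degree p. x - r i)"
    "\<And>i. i < degree p \<Longrightarrow> poly p (r i) = 0"
    by (rule poly_eq_prod_roots) blast
  have lt: "norm (x - r i) < norm (y - r i)" if "i < degree p" for i
    using assms(2) r(2) that by blast
  \<comment> \<open>Index 0 supplies the strict factor, which exists because the degree is positive;
    the larger factors are positive, so none of them annihilates the gain.\<close>
  have "(\<Prod>i<degree p. norm (x - r i)) < (\<Prod>i<degree p. norm (y - r i))"
  proof (rule prod_mono_strict)
    show "0 \<in> {..<degree p}" using assms(1) by simp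
    show "norm (x - r 0) < norm (y - r 0)" using lt assms(1) by blast
    show "0 < norm (y - r i)" if "i \<in> {..<degree p}" for i
      using lt[of i] that norm_ge_zero[of "x - r i"] by (metis lessThan_iff order_le_less_trans)
  qed (auto intro: less_imp_le lt)
  moreover have "lead_coeff p \<noteq> 0" using assms(1) by auto
  ultimately show ?thesis
    unfolding r(1) by (simp add: norm_mult flip: prod_norm)
qed

text \<open>The perpendicular bisector of \<open>x\<close> and \<open>x + d\<close> is the vertical
  line through \<open>x + d / 2\<close>, and \<open>z\<close> lies to its left, on the side of
  \<open>x\<close>.\<close>

lemma norm_diff_le_shift:
  fixes x z :: complex and d :: real
  assumes "d > 0" "Re x - Re z > - d / 2"
  shows "norm (x - z) \<le> norm (x + of_real d - z)"
proof -
  have "0 \<le> d * (2 * (Re x - Re z) + d)" using assms by (intro mult_nonneg_nonneg) auto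
  then have "(Re x - Re z)\<^sup>2 \<le> (Re x + d - Re z)\<^sup>2"
    by (simp add: power2_eq_square algebra_simps)
  then show ?thesis by (simp add: cmod_def)
qed

text \<open>If \<open>\<bar>r\<bar> < 1\<close>, applying \<open>T - r\<close> with \<open>T\<close> the shift by \<open>d\<close> moves the zeros
  of a polynomial to the left by at least \<open>d / 2\<close>.\<close>

lemma shift_combination_roots:
  fixes A :: "complex poly" and r :: "nat \<Rightarrow> complex" and d :: real
  assumes d: "d > 0" and A: "A \<noteq> 0" "\<And>z. poly A z = 0 \<Longrightarrow> Re z \<le> \<alpha>"
    and r: "\<And>i. i < n \<Longrightarrow> norm (r i) < 1"
  obtains E where "E \<noteq> 0" "\<And>z. poly E z = 0 \<Longrightarrow> Re z \<le> \<alpha> - real n * d / 2"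
    "\<And>z. poly E z = (\<Sum>k\<le>n. coeff (\<Prod>i<n. [:-r i, 1:]) k * poly A (z + of_real (real k * d)))"
proof -
  have "\<exists>E. E \<noteq> 0 \<and> (\<forall>z. poly E z = 0 \<longrightarrow> Re z \<le> \<alpha> - real n * d / 2) \<and>
    (\<forall>z. poly E z = (\<Sum>k\<le>n. coeff (\<Prod>i<n. [:-r i, 1:]) k * poly A (z + of_real (real k * d))))"
    using r
  proof (induction n)
    case 0
    then show ?case using A by (intro exI[of _ A]) simp
  next
    case (Suc n)
    then obtain E where E: "E \<noteq> 0" "\<And>z. poly E z = 0 \<Longrightarrow> Re z \<le> \<alpha> - real n * d / 2"
      "\<And>z. poly E z = (\<Sum>k\<le>n. coeff (\<Prod>i<n. [:-r i, 1:]) k * poly A (z + of_real (real k * d)))"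
      by auto
    let ?P = "\<Prod>i<n. [:-r i, 1:]"
    \<comment> \<open>\<open>D\<close> is \<open>(T - r n) E\<close> with \<open>T\<close> the shift
      by \<open>d\<close>: one linear factor is applied per induction step.\<close>
    define D where "D = pcompose E [:of_real d, 1:] - smult (r n) E"
    have D: "poly D z = poly E (z + of_real d) - r n * poly E z" for z
      by (simp add: D_def poly_pcompose add.commute)
    have roots: "Re z \<le> \<alpha> - real (Suc n) * d / 2" if z: "poly D z = 0" for z
    proof (rule ccontr)
      assume "\<not> ?thesis"
      then have gt: "Re z > \<alpha> - real n * d / 2 - d / 2" by (simp add: field_simps)
      \<comment> \<open>Right of the claimed bound, moving by \<open>d\<close> brings
        \<open>z\<close> no nearer to any root of \<open>E\<close>. But \<open>poly D z = 0\<close>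
        shrinks the modulus by the factor \<open>norm (r n) < 1\<close>, so both values vanish and
        \<open>z + d\<close> is a root of \<open>E\<close> too far to the right.\<close>
      have "norm (poly E z) \<le> norm (poly E (z + of_real d))"
      proof (rule norm_poly_le)
        fix w assume "poly E w = 0"
        then have "Re z - Re w > - d / 2" using E(2)[of w] gt by linarith
        then show "norm (z - w) \<le> norm (z + of_real d - w)"
          using norm_diff_le_shift d by blast
      qed
      moreover have eq: "poly E (z + of_real d) = r n * poly E z" using z D by simp
      ultimately have "1 * norm (poly E z) \<le> norm (r n) * norm (poly E z)"
        by (simp add: norm_mult)
      moreover have "norm (r n) < 1" using Suc.prems by simp
      ultimately have "poly E z = 0"
        by (metis linorder_not_le mult_strict_right_mono zero_less_norm_iff)
      then have "Re (z + of_real d) \<le> \<alpha> - real n * d / 2"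
        using eq E(2)[of "z + of_real d"] by simp
      then show False using gt d by simp
    qed
    \<comment> \<open>The zero polynomial would vanish at \<open>\<alpha> + 1\<close>, against the
      root bound just proved.\<close>
    have "D \<noteq> 0"
    proof
      assume "D = 0"
      then have "\<alpha> + 1 \<le> \<alpha> - real (Suc n) * d / 2" using roots[of "of_real (\<alpha> + 1)"] by simp
      moreover have "0 \<le> real (Suc n) * d / 2" using d by simp
      ultimately show False by linarith
    qed
    moreover have "poly D z = (\<Sum>k\<le>Suc n. coeff (\<Prod>i<Suc n. [:-r i, 1:]) k
      * poly A (z + of_real (real k * d)))" for z
    proof -
      have deg: "degree ?P = n" by (subst degree_prod_sum_eq) auto
      have P: "(\<Prod>i<Suc n. [:-r i, 1:]) = pCons 0 ?P - smult (r n) ?P"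
        by (simp add: mult.commute)
      have "(\<Sum>k\<le>Suc n. coeff (\<Prod>i<Suc n. [:-r i, 1:]) k * poly A (z + of_real (real k * d)))
        = (\<Sum>k\<le>Suc n. coeff (pCons 0 ?P) k * poly A (z + of_real (real k * d)))
          - r n * (\<Sum>k\<le>Suc n. coeff ?P k * poly A (z + of_real (real k * d)))"
        unfolding P by (simp add: sum_subtractf sum_distrib_left ring_distribs mult.assoc
            del: sum.atMost_Suc)
      also have "(\<Sum>k\<le>Suc n. coeff ?P k * poly A (z + of_real (real k * d))) = poly E z"
        using deg by (simp add: E(3) coeff_eq_0)
      also have "(\<Sum>k\<le>Suc n. coeff (pCons 0 ?P) k * poly A (z + of_real (real k * d)))
        = poly E (z + of_real d)"
        by (simp add: sum.atMost_Suc_shift E(3) algebra_simps del: sum.atMost_Suc)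
      finally show ?thesis by (simp add: D)
    qed
    ultimately show ?case using roots by blast
  qed
  then show ?thesis using that by blast
qed

text \<open>Multiplying the equation by \<open>\<rho> - z\<close> expresses \<open>z ^ Suc m\<close>
  through lower powers with coefficients \<open>\<rho> * c k - c (k - 1)\<close>, which are
  nonnegative and add up to at most \<open>\<rho>\<close>. For \<open>norm z \<ge> 1\<close> this is
  impossible. The uniform ratio \<open>\<rho> < 1\<close> excludes the unit circle as well.\<close>

lemma Enestrom_Kakeya_strict:
  fixes c :: "nat \<Rightarrow> real" and \<rho> :: real and z :: complex
  assumes c: "c m = 1" "\<And>k. k \<le> m \<Longrightarrow> c k > 0"
    and \<rho>: "\<rho> < 1" "\<And>k. k < m \<Longrightarrow> c k \<le> \<rho> * c (Suc k)" and "0 \<le> \<rho>"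
    and z: "(\<Sum>k\<le>m. of_real (c k) * z ^ k) = 0"
  shows "norm z < 1"
proof (rule ccontr)
  assume "\<not> ?thesis"
  then have z1: "norm z \<ge> 1" by simp
  \<comment> \<open>The case \<open>k = 0\<close> is separate because subtraction of naturals would
    turn \<open>c (0 - 1)\<close> into \<open>c 0\<close>.\<close>
  let ?d = "\<lambda>k. \<rho> * c k - (if k = 0 then 0 else c (k - 1))"
  have d: "?d k \<ge> 0" if "k \<le> m" for k
    using \<rho>(2)[of "k - 1"] c(2)[of k] \<open>0 \<le> \<rho>\<close> that by (cases k) auto
  have "(\<Sum>k\<le>m. of_real (?d k) * z ^ k) - of_real \<rho> * (\<Sum>k\<le>m. of_real (c k) * z ^ k)
    = - (\<Sum>k\<le>m. of_real (if k = 0 then 0 else c (k - 1)) * z ^ k)"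
    by (simp add: sum_distrib_left algebra_simps flip: sum_subtractf sum_negf)
  also have "(\<Sum>k\<le>m. of_real (if k = 0 then 0 else c (k - 1)) * z ^ k)
     = z * (\<Sum>k<m. of_real (c k) * z ^ k)"
    by (cases m) (simp_all add: sum.atMost_Suc_shift lessThan_Suc_atMost sum_distrib_left mult.left_commute del: sum.atMost_Suc)
  also have "(\<Sum>k<m. of_real (c k) * z ^ k) = - (z ^ m)"
    using z c(1) by (simp add: lessThan_Suc_atMost[symmetric] add_eq_0_iff2)
  finally have eq: "z ^ Suc m = (\<Sum>k\<le>m. of_real (?d k) * z ^ k)" using z by simp
  have "norm z ^ m * 1 \<le> norm z ^ Suc m" using z1 by (simp add: mult_le_cancel_right1)
  also have "\<dots> \<le> (\<Sum>k\<le>m. norm (of_real (?d k) * z ^ k))"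
    unfolding norm_power[symmetric] eq by (rule norm_sum)
  also have "\<dots> \<le> (\<Sum>k\<le>m. ?d k * norm z ^ m)"
  proof (rule sum_mono)
    fix k assume "k \<in> {..m}"
    then show "norm (of_real (?d k) * z ^ k) \<le> ?d k * norm z ^ m"
      using d[of k] z1 by (simp only: norm_mult norm_of_real norm_power abs_of_nonneg atMost_iff)
        (intro mult_left_mono power_increasing, auto)
  qed
  also have "\<dots> = norm z ^ m * (\<Sum>k\<le>m. ?d k)" by (simp add: sum_distrib_left mult.commute)
  finally have "norm z ^ m * 1 \<le> norm z ^ m * (\<Sum>k\<le>m. ?d k)" .
  moreover have "norm z ^ m > 0" using z1 by (intro zero_less_power) linarith
  ultimately have "1 \<le> (\<Sum>k\<le>m. ?d k)" by (rule mult_left_le_imp_le)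
  also have "(\<Sum>k\<le>m. ?d k) = \<rho> * (\<Sum>k\<le>m. c k) - (\<Sum>k<m. c k)"
    by (cases m) (simp_all add: sum_subtractf sum_distrib_left distrib_left sum.atMost_Suc_shift lessThan_Suc_atMost del: sum.atMost_Suc)
  also have "\<dots> = \<rho> - (1 - \<rho>) * (\<Sum>k<m. c k)"
    using c(1) by (simp add: lessThan_Suc_atMost[symmetric] algebra_simps)
  also have "0 \<le> (1 - \<rho>) * (\<Sum>k<m. c k)"
    using \<rho>(1) c(2) by (intro mult_nonneg_nonneg sum_nonneg) (auto simp: less_imp_le)
  then have "\<rho> - (1 - \<rho>) * (\<Sum>k<m. c k) \<le> \<rho>" by simp
  finally show False using \<rho>(1) by simp
qed

text \<open>By the reflection symmetry of \<open>A\<close> the sum is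
  \<open>E z + cnj (E (- cnj z))\<close>, where \<open>E\<close> collects the forward shifts. The
  roots of \<open>E\<close> lie in the open left half-plane, hence nearer to \<open>- cnj z\<close>
  than to \<open>z\<close>, so the first summand dominates strictly.\<close>

lemma symmetric_shift_sum_nonzero:
  fixes A :: "complex poly" and c :: "nat \<Rightarrow> real" and d :: real
  assumes A: "\<And>z. poly A z = 0 \<Longrightarrow> Re z = 0" "\<And>z. cnj (poly A (- cnj z)) = poly A z"
      "\<And>x::real. x \<ge> 0 \<Longrightarrow> Re (poly A (of_real x)) > 0"
    and d: "d > 0" and m: "m > 0"
    and c: "c m = 1" "\<And>k. k \<le> m \<Longrightarrow> c k > 0"
    and \<rho>: "0 \<le> \<rho>" "\<rho> < 1" "\<And>k. k < m \<Longrightarrow> c k \<le> \<rho> * c (Suc k)"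
    and z: "Re z > 0"
  shows "(\<Sum>k\<le>m. of_real (c k) * (poly A (z + of_real (real k * d)) + poly A (z - of_real (real k * d)))) \<noteq> 0"
proof
  assume *: "(\<Sum>k\<le>m. of_real (c k) * (poly A (z + of_real (real k * d)) + poly A (z - of_real (real k * d)))) = 0"
  define P where "P = (\<Sum>k\<le>m. monom (complex_of_real (c k)) k)"
  have coeffP: "coeff P k = (if k \<le> m then of_real (c k) else 0)" for k
    by (simp add: P_def coeff_sum if_distrib sum.delta cong: if_cong)
  have deg: "degree P = m"
    by (rule antisym[OF degree_le le_degree]) (auto simp: coeffP c(1))
  have lc: "lead_coeff P = 1" by (simp add: deg coeffP c(1))
  obtain r where r: "smult (lead_coeff P) (\<Prod>i<degree P. [:-r i, 1:]) = P"
    by (rule complex_poly_decompose')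
  then have P: "(\<Prod>i<m. [:-r i, 1:]) = P" unfolding lc by (simp add: deg)
  have r1: "norm (r i) < 1" if "i < m" for i
  proof (rule Enestrom_Kakeya_strict[OF c \<rho>(2,3,1)])
    have "poly P (r i) = 0" using that by (subst P[symmetric]) (auto simp: poly_prod)
    then show "(\<Sum>k\<le>m. complex_of_real (c k) * r i ^ k) = 0"
      by (simp add: P_def poly_sum poly_monom)
  qed
  have A0: "A \<noteq> 0" using A(3)[of 0] by auto
  have Ale: "\<And>z. poly A z = 0 \<Longrightarrow> Re z \<le> 0" using A(1) by fastforce
  obtain E where E1: "\<And>z. poly E z = 0 \<Longrightarrow> Re z \<le> 0 - real m * d / 2"
    and "\<And>z. poly E z = (\<Sum>k\<le>m. coeff (\<Prod>i<m. [:-r i, 1:]) k * poly A (z + of_real (real k * d)))"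
    by (rule shift_combination_roots[OF d A0 Ale, where n = m and r = r]) (use r1 in auto)
  then have E: "poly E z = (\<Sum>k\<le>m. of_real (c k) * poly A (z + of_real (real k * d)))" for z
    by (simp add: P coeffP)
  have "poly A (z - of_real (real k * d)) = cnj (poly A (- cnj z + of_real (real k * d)))" for k
    by (subst A(2)[symmetric]) simp
  then have sum0: "poly E z + cnj (poly E (- cnj z)) = 0"
    using * by (simp add: E sum.distrib ring_distribs)
  show False
  \<comment> \<open>A constant \<open>E\<close> has no roots to compare distances with; it is
    excluded because positivity of \<open>A\<close> on the nonnegative real axis gives it positive
    real part.\<close>
  proof (cases "degree E = 0")
    case True
    then obtain e where e: "E = [:e:]" by (rule degree_eq_zeroE)
    have "0 < (\<Sum>k\<le>m. c k * Re (poly A (of_real (real k * d))))"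
      using d by (intro sum_pos mult_pos_pos A(3) c(2)) auto
    also have "\<dots> = Re (poly E 0)" by (simp add: E)
    finally have "0 < Re e" by (simp add: e)
    moreover have "2 * Re e = 0" using arg_cong[OF sum0, of Re] by (simp add: e)
    ultimately show False by simp
  next
    case False
    have "norm (poly E (- cnj z)) < norm (poly E z)"
    proof (rule norm_poly_less)
      show "0 < degree E" using False by simp
      fix w assume "poly E w = 0"
      moreover have "real m * d / 2 > 0" using d m by simp
      ultimately have w: "Re w < 0" using E1[of w] by linarith
      have "0 < (- Re w) * Re z" using w z by (intro mult_pos_pos) auto
      then have "(- Re z - Re w)\<^sup>2 < (Re z - Re w)\<^sup>2"
        by (simp add: power2_eq_square algebra_simps)
      then show "norm (- cnj z - w) < norm (z - w)" by (simp add: cmod_def)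
    qed
    moreover have "norm (poly E z) = norm (poly E (- cnj z))"
      using sum0 by (metis add_eq_0_iff2 complex_mod_cnj norm_minus_cancel)
    ultimately show False by simp
  qed
qed

section \<open>Entire functions of minimal exponential type\<close>

text \<open>The full multiplicity is divided out at once, so \<open>g\<close> does not vanish at
  \<open>a\<close>. The factor \<open>1 - z / a\<close> is 1 at 0, so the normalisation of
  \<open>h\<close> passes on to \<open>g\<close>.\<close>

lemma factor_zero_entire:
  fixes h :: "complex \<Rightarrow> complex"
  assumes h: "h holomorphic_on UNIV" "h 0 = 1" and a: "h a = 0"
  obtains n g where "n > 0" "g holomorphic_on UNIV" "\<And>z. h z = (1 - z / a) ^ n * g z" "g a \<noteq> 0"
proof -
  have "a \<noteq> 0" using h(2) a by auto
  have nc: "\<not> h constant_on UNIV"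
    using h(2) a by (metis UNIV_I constant_on_def zero_neq_one)
  obtain g r n where g: "0 < n" "0 < r" "g holomorphic_on ball a r"
    "\<And>w. w \<in> ball a r \<Longrightarrow> h w = (w - a)^n * g w" "\<And>w. w \<in> ball a r \<Longrightarrow> g w \<noteq> 0"
    using holomorphic_factor_zero_nonconstant[OF h(1) open_UNIV connected_UNIV UNIV_I a nc] by metis
  \<comment> \<open>Near \<open>a\<close> the local cofactor is used, rescaled since
    \<open>(z - a) ^ n = (- a) ^ n * (1 - z / a) ^ n\<close>; elsewhere the quotient. The two agree
    off \<open>a\<close>, which makes \<open>G\<close> entire.\<close>
  define G where "G z = (if z \<in> ball a r then (- a) ^ n * g z else h z / (1 - z / a) ^ n)" for z
  have fac: "(1 - z / a) ^ n * (- a) ^ n = (z - a) ^ n" for z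
    using \<open>a \<noteq> 0\<close> by (simp add: power_mult_distrib[symmetric] left_diff_distrib)
  have nz: "1 - z / a \<noteq> 0" if "z \<noteq> a" for z
    using that \<open>a \<noteq> 0\<close> by (simp add: field_simps)
  have G: "G z = h z / (1 - z / a) ^ n" if "z \<noteq> a" for z
  proof (cases "z \<in> ball a r")
    case True
    have "h z = (1 - z / a) ^ n * ((- a) ^ n * g z)"
      unfolding g(4)[OF True] fac[symmetric] by (simp add: mult.assoc)
    then show ?thesis using True nz[OF that] that by (simp add: G_def)
  qed (auto simp: G_def)
  have "G holomorphic_on ball a r \<union> (UNIV - {a})"
  proof (rule holomorphic_on_Un)
    have "(\<lambda>z. (- a) ^ n * g z) holomorphic_on ball a r" by (intro holomorphic_intros g)
    then show "G holomorphic_on ball a r"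
      by (rule holomorphic_transform) (simp add: G_def)
    have "(\<lambda>z. h z / (1 - z / a) ^ n) holomorphic_on UNIV - {a}"
      using nz \<open>a \<noteq> 0\<close> by (intro holomorphic_intros holomorphic_on_subset[OF h(1)]) auto
    then show "G holomorphic_on UNIV - {a}"
      by (rule holomorphic_transform) (simp add: G)
  qed auto
  moreover have "ball a r \<union> (UNIV - {a}) = UNIV" using g(2) by auto
  ultimately have "G holomorphic_on UNIV" by simp
  moreover have "h z = (1 - z / a) ^ n * G z" for z
    using G[of z] nz[of z] a g(1) \<open>a \<noteq> 0\<close> by (cases "z = a") auto
  moreover have "G a \<noteq> 0" using g(2) g(5)[of a] \<open>a \<noteq> 0\<close> by (simp add: G_def)
  ultimately show ?thesis using g(1) that by blast
qed

text \<open>Induction on the number of distinct zeros in the disc, each removed with its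
  multiplicity. Outside radius \<open>2 * R\<close> every factor \<open>1 - z / a\<close> has
  modulus at least 1 because \<open>norm (z / a) \<ge> 2\<close>; this later lets bounds on
  \<open>h\<close> pass to \<open>g\<close>.\<close>

lemma factor_zeros_in_cball:
  fixes h :: "complex \<Rightarrow> complex"
  assumes "h holomorphic_on UNIV" "h 0 = 1"
  obtains p g where "poly p 0 = 1" "\<And>z. poly p z = 0 \<Longrightarrow> h z = 0 \<and> norm z \<le> R"
    "g holomorphic_on UNIV" "\<And>z. h z = poly p z * g z" "\<And>z. norm z \<le> R \<Longrightarrow> g z \<noteq> 0"
    "\<And>z. norm z \<ge> 2 * R \<Longrightarrow> norm (poly p z) \<ge> 1"
proof -
  define Z where "Z h = {z \<in> cball 0 R. h z = 0}" for h :: "complex \<Rightarrow> complex"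
  have fin: "finite (Z h)" if "h holomorphic_on UNIV" "h 0 = 1" for h
  proof (cases "h constant_on UNIV")
    case True
    then have "Z h = {}" using that(2) by (auto simp: Z_def constant_on_def)
    then show ?thesis by simp
  next
    case False
    then show ?thesis unfolding Z_def
      by (intro holomorphic_compact_finite_zeros[OF that(1) open_UNIV connected_UNIV compact_cball]) auto
  qed
  have "\<exists>p g. poly p 0 = 1 \<and> (\<forall>z. poly p z = 0 \<longrightarrow> h z = 0 \<and> norm z \<le> R) \<and>
    g holomorphic_on UNIV \<and> (\<forall>z. h z = poly p z * g z) \<and> (\<forall>z. norm z \<le> R \<longrightarrow> g z \<noteq> 0) \<and>
    (\<forall>z. norm z \<ge> 2 * R \<longrightarrow> norm (poly p z) \<ge> 1)"
    using assms
  proof (induction "card (Z h)" arbitrary: h rule: less_induct)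
    case less
    show ?case
    proof (cases "Z h = {}")
      case True
      then show ?thesis using less.prems
        by (intro exI[of _ 1] exI[of _ h]) (auto simp: Z_def)
    next
      case False
      then obtain a where a: "norm a \<le> R" "h a = 0" by (auto simp: Z_def)
      have "a \<noteq> 0" using a less.prems by auto
      obtain n g where g: "n > 0" "g holomorphic_on UNIV" "\<And>z. h z = (1 - z / a) ^ n * g z" "g a \<noteq> 0"
        using factor_zero_entire[OF less.prems a(2)] by metis
      have "g 0 = 1" using g(3)[of 0] less.prems by simp
      have "Z g \<subset> Z h" using a g by (auto simp: Z_def)
      then have "card (Z g) < card (Z h)" using fin less.prems by (intro psubset_card_mono) auto
      from less.hyps[OF this g(2) \<open>g 0 = 1\<close>]
      obtain p f where p: "poly p 0 = 1" "\<And>z. poly p z = 0 \<Longrightarrow> g z = 0 \<and> norm z \<le> R"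
        "f holomorphic_on UNIV" "\<And>z. g z = poly p z * f z" "\<And>z. norm z \<le> R \<Longrightarrow> f z \<noteq> 0"
        "\<And>z. norm z \<ge> 2 * R \<Longrightarrow> norm (poly p z) \<ge> 1"
        by metis
      let ?q = "[:1, - 1 / a:] ^ n * p"
      have q: "poly ?q z = (1 - z / a) ^ n * poly p z" for z by simp
      have "norm (poly ?q z) \<ge> 1" if "norm z \<ge> 2 * R" for z
      proof -
        have "2 * norm a \<le> norm z" using that a by linarith
        then have "2 \<le> norm (z / a)" using \<open>a \<noteq> 0\<close> by (simp add: norm_divide field_simps)
        then have "1 \<le> norm (1 - z / a)"
          using norm_triangle_ineq2[of "z / a" 1] by (simp add: norm_minus_commute)
        then have "1 * 1 \<le> norm (1 - z / a) ^ n * norm (poly p z)"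
          using p(6)[OF that] by (intro mult_mono) auto
        then show ?thesis unfolding q by (simp add: norm_mult norm_power)
      qed
      moreover have "h z = 0 \<and> norm z \<le> R" if "poly ?q z = 0" for z
      proof (cases "poly p z = 0")
        case True
        then show ?thesis using p(2) g(3) by simp
      next
        case False
        then have "1 - z / a = 0" using that unfolding q by simp
        then have "z = a" using \<open>a \<noteq> 0\<close> by (simp add: field_simps)
        then show ?thesis using a by simp
      qed
      ultimately show ?thesis
        using p g(3) unfolding q[abs_def]
        by (intro exI[of _ ?q] exI[of _ f]) (simp add: mult.assoc)
    qed
  qed
  then show ?thesis using that by blast
qed

text \<open>Since \<open>Re L < M\<close>, the value of \<open>L\<close> is nearer to 0 than to
  \<open>2 * M\<close>, so \<open>L / (2 * M - L)\<close> maps the disc into the unit disc and fixes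
  0. The Schwarz lemma bounds it by \<open>norm z / R\<close>, and
  \<open>norm z / R \<le> 1 / 2\<close> allows solving for \<open>norm (L z)\<close>.\<close>

lemma Borel_Caratheodory_at_0:
  fixes L :: "complex \<Rightarrow> complex"
  assumes L: "L holomorphic_on ball 0 R" "L 0 = 0" and M: "\<And>z. norm z < R \<Longrightarrow> Re (L z) < M"
    and z: "norm z \<le> R / 2" "R > 0"
  shows "norm (L z) \<le> 4 * M * norm z / R"
proof -
  have "M > 0" using M[of 0] L(2) z by simp
  define f where "f w = L (of_real R * w) / (2 * of_real M - L (of_real R * w))" for w
  have in_ball: "norm (of_real R * w) < R" if "norm w < 1" for w :: complex
    using that z by (simp add: norm_mult)
  have den: "2 * of_real M - L (of_real R * w) \<noteq> 0" if "norm w < 1" for w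
    using M[OF in_ball[OF that]] \<open>M > 0\<close> by (auto simp: complex_eq_iff)
  have "f holomorphic_on ball 0 1" unfolding f_def
  proof (intro holomorphic_intros)
    show "(\<lambda>w. L (of_real R * w)) holomorphic_on ball 0 1"
      using in_ball by (intro holomorphic_on_compose_gen[OF _ L(1), unfolded o_def] holomorphic_intros) auto
    then show "(\<lambda>w. L (of_real R * w)) holomorphic_on ball 0 1" .
  qed (use den in auto)
  moreover have "norm (f w) < 1" if "norm w < 1" for w
  proof -
    let ?l = "L (of_real R * w)"
    have "Re ?l < M" using M in_ball that by blast
    then have "0 < M * (M - Re ?l)" using \<open>M > 0\<close> by simp
    then have "(Re ?l)\<^sup>2 < (2 * M - Re ?l)\<^sup>2" by (simp add: power2_eq_square algebra_simps)
    then have "norm ?l < norm (2 * of_real M - ?l)" by (simp add: cmod_def)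
    then show ?thesis using den[OF that] by (simp add: f_def norm_divide)
  qed
  moreover have "f 0 = 0" by (simp add: f_def L)
  ultimately have sch: "norm (f w) \<le> norm w" if "norm w < 1" for w
    using Schwarz_Lemma(1) that by blast
  let ?w = "z / of_real R"
  have w: "norm ?w \<le> 1 / 2" using z by (simp add: norm_divide field_simps)
  then have w1: "norm ?w < 1" by linarith
  let ?l = "L z"
  have "norm ?l \<le> norm ?w * norm (2 * of_real M - ?l)"
    using sch[OF w1] den[OF w1] z(2) by (simp add: f_def norm_divide field_simps)
  also have "\<dots> \<le> norm ?w * (2 * M + norm ?l)"
    using norm_triangle_ineq4[of "2 * of_real M" ?l] \<open>M > 0\<close> by (intro mult_left_mono) (auto simp: norm_mult)
  also have "\<dots> = norm ?w * (2 * M) + norm ?w * norm ?l" by (simp add: algebra_simps)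
  also have "norm ?w * norm ?l \<le> (1 / 2) * norm ?l" using w by (intro mult_right_mono) auto
  finally have "norm ?l \<le> 4 * M * norm ?w" by (simp add: mult_ac del: norm_divide)
  then show ?thesis using z(2) by (simp add: norm_divide)
qed

text \<open>\<open>p\<close> carries the zeros in the disc of radius \<open>R\<close>, so the
  cofactor is an exponential there. On the circle of radius \<open>2 * R\<close> it is no larger
  than \<open>h\<close>; the maximum principle brings the bound inside, and Borel-Caratheodory turns
  it into one for the exponent. \<open>M\<close> is quantified after \<open>p\<close>, so
  \<open>p\<close> depends on \<open>h\<close> and \<open>R\<close> only.\<close>

lemma partial_product_approximation:
  fixes h :: "complex \<Rightarrow> complex"
  assumes h: "h holomorphic_on UNIV" "h 0 = 1" and R: "R > 0"
  obtains p where "poly p 0 = 1" "\<And>z. poly p z = 0 \<Longrightarrow> h z = 0"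
    "\<And>M z. (\<And>w. norm w = 2 * R \<Longrightarrow> norm (h w) \<le> exp M) \<Longrightarrow> norm z \<le> R / 2 \<Longrightarrow>
      \<exists>l. h z = poly p z * exp l \<and> norm l \<le> 4 * (M + 1) * norm z / R"
proof -
  obtain p g where p: "poly p 0 = 1" "\<And>z. poly p z = 0 \<Longrightarrow> h z = 0 \<and> norm z \<le> R"
    "g holomorphic_on UNIV" "\<And>z. h z = poly p z * g z" "\<And>z. norm z \<le> R \<Longrightarrow> g z \<noteq> 0"
    "\<And>z. norm z \<ge> 2 * R \<Longrightarrow> norm (poly p z) \<ge> 1"
    using factor_zeros_in_cball[OF h, of R] by metis
  have "g 0 = 1" using p(4)[of 0] p(1) h(2) by simp
  obtain L0 where L0: "L0 holomorphic_on ball 0 R" "\<And>z. z \<in> ball 0 R \<Longrightarrow> exp (L0 z) = g z"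
    using holomorphic_logarithm_exists[OF convex_ball open_ball holomorphic_on_subset[OF p(3)], of 0 R 0] p(5) R
    by (metis centre_in_ball dist_0_norm less_eq_real_def mem_ball subset_UNIV)
  define L where "L z = L0 z - L0 0" for z
  have L: "L holomorphic_on ball 0 R" "L 0 = 0" "\<And>z. norm z < R \<Longrightarrow> exp (L z) = g z"
    unfolding L_def using L0 L0(2)[of 0] R \<open>g 0 = 1\<close>
    by (auto simp: exp_diff intro!: holomorphic_intros)
  have "\<exists>l. h z = poly p z * exp l \<and> norm l \<le> 4 * (M + 1) * norm z / R"
    if M: "\<And>w. norm w = 2 * R \<Longrightarrow> norm (h w) \<le> exp M" and z: "norm z \<le> R / 2" for M z
  proof -
    have gM: "norm (g w) \<le> exp M" if "norm w < R" for w
    proof (rule maximum_modulus_frontier[of g "cball 0 (2 * R)"])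
      show "g holomorphic_on interior (cball 0 (2 * R))" using p(3) holomorphic_on_subset by blast
      show "continuous_on (closure (cball 0 (2 * R))) g"
        using p(3) holomorphic_on_imp_continuous_on holomorphic_on_subset by blast
      show "w \<in> cball 0 (2 * R)" using that R by auto
      fix u :: complex assume "u \<in> frontier (cball 0 (2 * R))"
      then have u: "norm u = 2 * R" using R by (simp add: frontier_cball)
      then have "1 * norm (g u) \<le> norm (poly p u) * norm (g u)"
        using p(6)[of u] by (intro mult_right_mono) auto
      also have "\<dots> = norm (h u)" by (simp add: p(4) norm_mult)
      also have "\<dots> \<le> exp M" by (rule M[OF u])
      finally show "norm (g u) \<le> exp M" by simp
    qed auto
    \<comment> \<open>The added 1 gives the strict inequality that
      \<open>Borel_Caratheodory_at_0\<close> asks for.\<close>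
    have "Re (L w) < M + 1" if "norm w < R" for w
      using gM[OF that] L(3)[OF that] by (metis add_0 add_less_mono1 exp_le_cancel_iff le_less_trans less_add_one norm_exp_eq_Re)
    from Borel_Caratheodory_at_0[OF L(1,2) this z R]
    have "norm (L z) \<le> 4 * (M + 1) * norm z / R" by simp
    moreover have "norm z < R" using z R by linarith
    then have "h z = poly p z * exp (L z)" using p(4) L(3) by simp
    ultimately show ?thesis by blast
  qed
  with p(1,2) show ?thesis by (intro that[of p]) auto
qed

lemma norm_exp_minus_one_le:
  fixes l :: complex
  assumes "norm l \<le> 1"
  shows "norm (exp l - 1) \<le> 3 * norm l"
proof -
  have "norm (exp l - exp 0) \<le> 3 * norm (l - 0)"
  proof (rule field_differentiable_bound[of "cball 0 1" exp exp])
    fix x :: complex assume "x \<in> cball 0 1"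
    then have "Re x \<le> 1" using complex_Re_le_cmod[of x] by simp
    then have "norm (exp x) \<le> exp 1" by (simp add: norm_exp_eq_Re)
    then show "norm (exp x) \<le> 3" using exp_le by linarith
    show "(exp has_field_derivative exp x) (at x within cball 0 1)"
      by (rule DERIV_subset[OF DERIV_exp]) simp
  qed (use assms in auto)
  then show ?thesis by simp
qed

text \<open>Hadamard's factorisation for minimal exponential type, in the form of an approximation
  by the partial products over the zeros in a disc.\<close>

lemma minimal_type_poly_approximation:
  fixes h :: "complex \<Rightarrow> complex"
  assumes h: "h holomorphic_on UNIV" "h 0 = 1"
    and growth: "\<And>\<epsilon>::real. \<epsilon> > 0 \<Longrightarrow> \<exists>C. \<forall>z. norm (h z) \<le> exp (C + \<epsilon> * norm z)"
  obtains p :: "nat \<Rightarrow> complex poly" where "\<And>n. poly (p n) 0 = 1"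
    "\<And>n z. poly (p n) z = 0 \<Longrightarrow> h z = 0"
    "\<And>r. uniform_limit (cball 0 r) (\<lambda>n. poly (p n)) h sequentially"
proof -
  have "\<exists>p. poly p 0 = 1 \<and> (\<forall>z. poly p z = 0 \<longrightarrow> h z = 0) \<and>
    (\<forall>M z. (\<forall>w. norm w = 2 * R \<longrightarrow> norm (h w) \<le> exp M) \<longrightarrow> norm z \<le> R / 2 \<longrightarrow>
      (\<exists>l. h z = poly p z * exp l \<and> norm l \<le> 4 * (M + 1) * norm z / R))" if "R > 0" for R
    using partial_product_approximation[OF h that] by metis
  then have "\<exists>p. \<forall>n. poly (p n) 0 = 1 \<and> (\<forall>z. poly (p n) z = 0 \<longrightarrow> h z = 0) \<and>
    (\<forall>M z. (\<forall>w. norm w = 2 * real (Suc n) \<longrightarrow> norm (h w) \<le> exp M) \<longrightarrow> norm z \<le> real (Suc n) / 2 \<longrightarrow>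
      (\<exists>l. h z = poly (p n) z * exp l \<and> norm l \<le> 4 * (M + 1) * norm z / real (Suc n)))"
    by (intro choice allI) (simp only: of_nat_0_less_iff zero_less_Suc)
  then obtain p where p: "\<And>n. poly (p n) 0 = 1" "\<And>n z. poly (p n) z = 0 \<Longrightarrow> h z = 0"
    "\<And>n M z. (\<And>w. norm w = 2 * real (Suc n) \<Longrightarrow> norm (h w) \<le> exp M) \<Longrightarrow> norm z \<le> real (Suc n) / 2 \<Longrightarrow>
      \<exists>l. h z = poly (p n) z * exp l \<and> norm l \<le> 4 * (M + 1) * norm z / real (Suc n)"
    by metis
  have "uniform_limit (cball 0 r) (\<lambda>n. poly (p n)) h sequentially" for r
  proof (cases "r \<ge> 0")
    case False
    then show ?thesis by simp
  next
    case r: True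
    have "continuous_on (cball 0 r) h"
      using h(1) holomorphic_on_imp_continuous_on holomorphic_on_subset by blast
    then have "bounded (h ` cball 0 r)"
      by (intro compact_imp_bounded compact_continuous_image compact_cball)
    then obtain B where B: "B > 0" "\<And>z. norm z \<le> r \<Longrightarrow> norm (h z) \<le> B"
      unfolding bounded_pos by auto
    show ?thesis
    proof (rule uniform_limitI)
      fix e :: real assume e: "e > 0"
      \<comment> \<open>Once \<open>norm l \<le> \<eta> \<le> 1\<close>, the error is at most
        \<open>B * (3 * \<eta>)\<close>, which is below
        \<open>4 * B * \<eta> \<le> e\<close>.\<close>
      define \<eta> where "\<eta> = min 1 (e / (4 * B))"
      have \<eta>: "\<eta> > 0" "\<eta> \<le> 1" "\<eta> \<le> e / (4 * B)" using e B by (auto simp: \<eta>_def)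
      \<comment> \<open>In the bound on \<open>l\<close> the part of the exponent linear in the
        radius contributes \<open>8 * \<epsilon> * (r + 1) = \<eta> / 2\<close>. The second entry of
        \<open>N\<close> below keeps the constant part at most \<open>\<eta> / 2\<close>, and the
        entry \<open>2 * r\<close> keeps \<open>z\<close> in the half disc.\<close>
      define \<epsilon> where "\<epsilon> = \<eta> / (16 * (r + 1))"
      have \<epsilon>: "\<epsilon> > 0" using \<eta> r by (simp add: \<epsilon>_def)
      obtain C where C: "\<And>z. norm (h z) \<le> exp (C + \<epsilon> * norm z)" using growth[OF \<epsilon>] by blast
      define N where "N = max (2 * r) (8 * (\<bar>C\<bar> + 1) * (r + 1) / \<eta>)"
      have "\<forall>\<^sub>F n in sequentially. real (Suc n) \<ge> N"
        by (intro eventually_sequentiallyI[of "nat \<lceil>N\<rceil>"]) linarith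
      then show "\<forall>\<^sub>F n in sequentially. \<forall>z\<in>cball 0 r. dist (poly (p n) z) (h z) < e"
      proof (rule eventually_mono, intro ballI)
        fix n and z :: complex assume n: "real (Suc n) \<ge> N" and "z \<in> cball 0 r"
        let ?R = "real (Suc n)"
        have z: "norm z \<le> r" using \<open>z \<in> cball 0 r\<close> by simp
        have nR: "?R \<ge> 2 * r" "?R \<ge> 8 * (\<bar>C\<bar> + 1) * (r + 1) / \<eta>" using n by (auto simp: N_def)
        define M where "M = \<bar>C\<bar> + \<epsilon> * (2 * ?R)"
        have "norm (h w) \<le> exp M" if "norm w = 2 * ?R" for w
          using C[of w] that unfolding M_def
          by (smt (verit) exp_le_cancel_iff)
        moreover have "norm z \<le> ?R / 2" using z nR by simp
        ultimately obtain l where l: "h z = poly (p n) z * exp l" "norm l \<le> 4 * (M + 1) * norm z / ?R"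
          using p(3) by blast
        have "norm l \<le> 4 * (M + 1) * (r + 1) / ?R"
          using z \<epsilon> by (intro order_trans[OF l(2)] divide_right_mono mult_left_mono) (auto simp: M_def)
        also have "\<dots> = 4 * (\<bar>C\<bar> + 1) * (r + 1) / ?R + 8 * \<epsilon> * (r + 1)"
          unfolding M_def by (simp add: field_simps)
        also have "4 * (\<bar>C\<bar> + 1) * (r + 1) / ?R \<le> \<eta> / 2"
          using nR(2) \<eta> by (simp add: field_simps)
        also have "8 * \<epsilon> * (r + 1) = \<eta> / 2" using r by (simp add: \<epsilon>_def field_simps)
        finally have l\<eta>: "norm l \<le> \<eta>" by simp
        have "poly (p n) z - h z = h z * (exp (- l) - 1)"
          unfolding l(1) by (simp add: algebra_simps exp_minus)
        then have "norm (poly (p n) z - h z) = norm (h z) * norm (exp (- l) - 1)"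
          by (simp add: norm_mult)
        also have "\<dots> \<le> B * (3 * \<eta>)"
          using l\<eta> \<eta> B(2)[OF z] norm_exp_minus_one_le[of "- l"] B(1)
          by (intro mult_mono) auto
        also have "\<dots> < B * (4 * \<eta>)" using B \<eta> by simp
        also have "\<dots> \<le> e" using \<eta> B by (simp add: field_simps)
        finally show "dist (poly (p n) z) (h z) < e" by (simp add: dist_norm)
      qed
    qed
  qed
  with p(1,2) show ?thesis by (rule that)
qed

section \<open>From polynomials to even entire functions\<close>

lemma uniform_limit_sum:
  fixes f :: "'i \<Rightarrow> 'n \<Rightarrow> 'a \<Rightarrow> 'b::real_normed_vector"
  assumes "\<And>i. i \<in> I \<Longrightarrow> uniform_limit S (f i) (g i) F"
  shows "uniform_limit S (\<lambda>n x. \<Sum>i\<in>I. f i n x) (\<lambda>x. \<Sum>i\<in>I. g i x) F"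
  using assms
  by (induction I rule: infinite_finite_induct) (auto intro!: uniform_limit_add uniform_limit_const)

text \<open>By evenness \<open>H\<close> takes the same value at both square roots of
  \<open>w\<close>. The branches \<open>csqrt w\<close> and \<open>\<i> * csqrt (- w)\<close> are
  holomorphic off the negative and the positive axis, which together cover the punctured plane; 0 is
  removable by continuity.\<close>

lemma even_entire_eq_square:
  fixes H :: "complex \<Rightarrow> complex"
  assumes H: "H holomorphic_on UNIV" and even: "\<And>z. H (- z) = H z"
  obtains h where "h holomorphic_on UNIV" "\<And>z. H z = h (z\<^sup>2)"
proof -
  define h where "h w = H (csqrt w)" for w
  have eq: "H z = h w" if "z\<^sup>2 = w" for z w
  proof -
    have "z = csqrt w \<or> z = - csqrt w" using that power2_eq_iff[of z "csqrt w"] by simp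
    then show ?thesis using even by (auto simp: h_def)
  qed
  have "h holomorphic_on - \<real>\<^sub>\<le>\<^sub>0"
    unfolding h_def
    by (intro holomorphic_on_compose_gen[OF _ H, unfolded o_def] holomorphic_intros) auto
  moreover have "h holomorphic_on - \<real>\<^sub>\<ge>\<^sub>0"
  proof -
    have "(\<lambda>w. H (\<i> * csqrt (- w))) holomorphic_on - \<real>\<^sub>\<ge>\<^sub>0"
      by (intro holomorphic_on_compose_gen[OF _ H, unfolded o_def] holomorphic_intros)
        (auto simp: complex_nonpos_Reals_iff complex_nonneg_Reals_iff)
    then show ?thesis
      by (rule holomorphic_transform) (auto intro!: eq simp: power_mult_distrib)
  qed
  ultimately have "h holomorphic_on - \<real>\<^sub>\<le>\<^sub>0 \<union> - \<real>\<^sub>\<ge>\<^sub>0"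
    by (intro holomorphic_on_Un) (auto simp: open_Compl)
  also have "- \<real>\<^sub>\<le>\<^sub>0 \<union> - \<real>\<^sub>\<ge>\<^sub>0 = UNIV - {0 :: complex}"
    by (auto simp: complex_nonpos_Reals_iff complex_nonneg_Reals_iff complex_eq_iff)
  finally have punctured: "h holomorphic_on UNIV - {0}" .
  have "(h \<longlongrightarrow> h 0) (at 0)"
  proof -
    have "isCont H 0" using H holomorphic_on_imp_continuous_on continuous_on_eq_continuous_at by blast
    moreover have "(csqrt \<longlongrightarrow> 0) (at 0)"
    proof (rule tendsto_norm_zero_cancel)
      have "isCont (\<lambda>w::complex. sqrt (norm w)) 0" by (intro continuous_intros)
      then show "((\<lambda>w. norm (csqrt w)) \<longlongrightarrow> 0) (at 0)" by (simp add: norm_csqrt isCont_def)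
    qed
    ultimately show ?thesis unfolding h_def
      by (simp add: isCont_tendsto_compose)
  qed
  then have "h holomorphic_on UNIV"
    by (intro no_isolated_singularity'[OF _ punctured]) auto
  with eq show ?thesis using that by blast
qed

text \<open>With roots \<open>- s i\<close>, \<open>s i > 0\<close>, the condition
  \<open>poly p 0 = 1\<close> forces the leading coefficient to be the positive number
  \<open>1 / (\<Prod>i<degree p. s i)\<close>, so \<open>p\<close> is a positive multiple of a
  product of factors \<open>z + s i\<close>.\<close>

lemma poly_negative_roots:
  fixes p :: "complex poly"
  assumes p0: "poly p 0 = 1" and neg: "\<And>z. poly p z = 0 \<Longrightarrow> Im z = 0 \<and> Re z < 0"
  shows "cnj (poly p (cnj z)) = poly p z"
    and "x \<ge> 0 \<Longrightarrow> Re (poly p (of_real x)) > 0"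
proof -
  obtain r where r: "\<And>x. poly p x = lead_coeff p * (\<Prod>i<degree p. x - r i)"
    "\<And>i. i < degree p \<Longrightarrow> poly p (r i) = 0"
    by (rule poly_eq_prod_roots) blast
  define s where "s i = - Re (r i)" for i
  have s: "s i > 0" "r i = - of_real (s i)" if "i < degree p" for i
    using neg[OF r(2)[OF that]] by (auto simp: s_def complex_eq_iff)
  have eq: "poly p z = lead_coeff p * (\<Prod>i<degree p. z + of_real (s i))" for z
    unfolding r(1) using s(2) by (intro arg_cong2[where f = "(*)"] prod.cong) auto
  have "lead_coeff p * of_real (\<Prod>i<degree p. s i) = 1"
    using p0 eq[of 0] by simp
  moreover have pos: "(\<Prod>i<degree p. s i) > 0" using s(1) by (intro prod_pos) auto
  ultimately have lc: "lead_coeff p = of_real (1 / (\<Prod>i<degree p. s i))"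
    unfolding of_real_divide of_real_1
    by (intro eq_divide_imp) (metis less_irrefl of_real_eq_0_iff)
  show "cnj (poly p (cnj z)) = poly p z"
    unfolding eq lc by simp
  assume "x \<ge> 0"
  then have "(\<Prod>i<degree p. x + s i) > 0" using s(1) by (intro prod_pos) (simp add: add_nonneg_pos)
  then have "1 / (\<Prod>i<degree p. s i) * (\<Prod>i<degree p. x + s i) > 0"
    using pos by (intro mult_pos_pos divide_pos_pos) auto
  moreover have "poly p (of_real x) = of_real (1 / (\<Prod>i<degree p. s i) * (\<Prod>i<degree p. x + s i))"
    unfolding eq lc by simp
  ultimately show "Re (poly p (of_real x)) > 0" by (simp only: Re_complex_of_real)
qed

text \<open>Writing \<open>H z = H 0 * h (z\<^sup>2)\<close> halves the order of growth, so
  \<open>h\<close> is a limit of polynomials \<open>p n\<close> whose zeros are zeros of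
  \<open>h\<close>, hence negative. The polynomials \<open>p n\<close> in \<open>z\<^sup>2\<close>
  satisfy \<open>symmetric_shift_sum_nonzero\<close>, and Hurwitz's theorem passes to the
  limit.\<close>

lemma symmetric_shift_sum_entire_zeros:
  fixes H :: "complex \<Rightarrow> complex" and c :: "nat \<Rightarrow> real" and d :: real
  assumes H: "H holomorphic_on UNIV" "\<And>z. H (- z) = H z"
    and zeros: "\<And>z. H z = 0 \<Longrightarrow> Re z = 0"
    and pos: "\<And>x::real. Re (H (of_real x)) > 0"
    and growth: "\<And>\<epsilon>::real. \<epsilon> > 0 \<Longrightarrow> \<exists>C. \<forall>z. norm (H z) \<le> exp (C + \<epsilon> * (norm z)\<^sup>2)"
    and d: "d > 0" and m: "m > 0"
    and c: "c m = 1" "\<And>k. k \<le> m \<Longrightarrow> c k > 0"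
    and \<rho>: "0 \<le> \<rho>" "\<rho> < 1" "\<And>k. k < m \<Longrightarrow> c k \<le> \<rho> * c (Suc k)"
    and z: "(\<Sum>k\<le>m. of_real (c k) * (H (z + of_real (real k * d)) + H (z - of_real (real k * d)))) = 0"
  shows "Re z = 0"
proof -
  define \<Sigma> where "\<Sigma> H z = (\<Sum>k\<le>m. of_real (c k) * (H (z + of_real (real k * d)) + H (z - of_real (real k * d))))"
    for H :: "complex \<Rightarrow> complex" and z
  have H0: "H 0 \<noteq> 0" using pos[of 0] by auto
  obtain h0 where h0: "h0 holomorphic_on UNIV" "\<And>z. H z = h0 (z\<^sup>2)"
    using even_entire_eq_square[OF H] by metis
  define h where "h w = h0 w / H 0" for w
  have h: "h holomorphic_on UNIV" "h 0 = 1"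
    using h0(1) h0(2)[of 0] H0 by (auto simp: h_def[abs_def] intro!: holomorphic_intros)
  have hH: "h (z\<^sup>2) = H z / H 0" for z by (simp add: h_def h0(2))
  have \<Sigma>h: "\<Sigma> (\<lambda>z. h (z\<^sup>2)) w = \<Sigma> H w / H 0" for w
    by (simp add: \<Sigma>_def hH sum_divide_distrib add_divide_distrib distrib_left)
  have h_csqrt: "h w = H (csqrt w) / H 0" for w using hH[of "csqrt w"] by simp
  have "\<exists>C. \<forall>w. norm (h w) \<le> exp (C + \<epsilon> * norm w)" if "\<epsilon> > 0" for \<epsilon>
  proof -
    obtain C where C: "\<And>z. norm (H z) \<le> exp (C + \<epsilon> * (norm z)\<^sup>2)" using growth[OF \<open>\<epsilon> > 0\<close>] by blast
    have "norm (h w) \<le> exp (C - ln (norm (H 0)) + \<epsilon> * norm w)" for w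
    proof -
      have "norm (h w) \<le> exp (C + \<epsilon> * norm w) / norm (H 0)"
        using C[of "csqrt w"] H0 by (simp add: h_csqrt norm_divide norm_csqrt divide_right_mono)
      also have "\<dots> = exp (C - ln (norm (H 0)) + \<epsilon> * norm w)"
        using H0 by (simp add: exp_diff exp_add)
      finally show ?thesis .
    qed
    then show ?thesis by blast
  qed
  then obtain p where p: "\<And>n. poly (p n) 0 = 1" "\<And>n z. poly (p n) z = 0 \<Longrightarrow> h z = 0"
    "\<And>r. uniform_limit (cball 0 r) (\<lambda>n. poly (p n)) h sequentially"
    using minimal_type_poly_approximation[OF h] by metis
  have hneg: "Im w = 0 \<and> Re w < 0" if "h w = 0" for w
  proof -
    obtain s where s: "w = s\<^sup>2" by (metis power2_csqrt)
    have "H s = 0" using that hH[of s] H0 by (simp add: s)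
    then have "Re s = 0" "s \<noteq> 0" using zeros H0 by auto
    then show ?thesis by (auto simp: s Re_power2 Im_power2 complex_eq_iff)
  qed
  have nz: "\<Sigma> (\<lambda>z. poly (p n) (z\<^sup>2)) z \<noteq> 0" if "Re z > 0" for n z
  proof -
    define A where "A = pcompose (p n) [:0, 0, 1:]"
    have A: "poly A z = poly (p n) (z\<^sup>2)" for z
      by (simp add: A_def poly_pcompose power2_eq_square)
    note neg = poly_negative_roots[OF p(1)[of n] hneg[OF p(2)[of n]]]
    have "\<Sigma> (poly A) z \<noteq> 0" unfolding \<Sigma>_def
    proof (rule symmetric_shift_sum_nonzero[OF _ _ _ d m c \<rho> that])
      show "Re z = 0" if "poly A z = 0" for z
        using hneg[OF p(2), of n "z\<^sup>2"] that by (auto simp: A Re_power2 Im_power2)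
      show "cnj (poly A (- cnj z)) = poly A z" for z
        using neg(1)[of "z\<^sup>2"] by (simp add: A)
      show "0 < Re (poly A (of_real x))" for x
        using neg(2)[of "x\<^sup>2"] by (simp add: A)
    qed
    then show ?thesis by (simp add: \<Sigma>_def A)
  qed
  have even: "\<Sigma> H (- z) = \<Sigma> H z" for z
  proof -
    have "H (- z + w) = H (z - w)" "H (- z - w) = H (z + w)" for w
      using H(2)[of "z - w"] H(2)[of "z + w"] by simp_all
    then show ?thesis unfolding \<Sigma>_def by (simp add: add.commute)
  qed
  have nonzero: "\<Sigma> H w \<noteq> 0" if w: "Re w > 0" for w
  proof -
    let ?S = "{z. Re z > 0}"
    have False if w0: "\<Sigma> (\<lambda>z. h (z\<^sup>2)) w = 0"
    proof (rule notE[OF _ w0], 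
        rule Hurwitz_no_zeros[where S = ?S and \<F> = "\<lambda>n. \<Sigma> (\<lambda>z. poly (p n) (z\<^sup>2))"
          and g = "\<Sigma> (\<lambda>z. h (z\<^sup>2))" and ?z0.0 = w])
      show "open ?S" by (rule open_halfspace_Re_gt)
      show "connected ?S" by (intro convex_connected convex_halfspace_Re_gt)
      show "\<Sigma> (\<lambda>z. poly (p n) (z\<^sup>2)) holomorphic_on ?S" for n
        unfolding \<Sigma>_def[abs_def] by (intro holomorphic_intros)
      have shift: "(\<lambda>z. H (z + a)) holomorphic_on ?S" for a
        by (rule holomorphic_on_compose_gen[OF _ H(1), unfolded o_def]) (auto intro: holomorphic_intros)
      show "\<Sigma> (\<lambda>z. h (z\<^sup>2)) holomorphic_on ?S"
        unfolding \<Sigma>_def[abs_def] hH using H0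
        by (intro holomorphic_intros shift shift[of "- a" for a, unfolded add_uminus_conv_diff])
      \<comment> \<open>Hurwitz's theorem requires a nonconstant limit: it is nonzero at 1, by
        positivity of \<open>Re H\<close> on the real axis, and supposed to vanish at
        \<open>w\<close>.\<close>
      have "Re (\<Sigma> H 1) > 0"
        unfolding \<Sigma>_def Re_sum using c(2)
      proof (intro sum_pos)
        fix k assume "k \<in> {..m}"
        have "H (1 + of_real (real k * d)) + H (1 - of_real (real k * d)) = H (of_real (1 + real k * d)) + H (of_real (1 - real k * d))"
          by simp
        then show "0 < Re (of_real (c k) * (H (1 + of_real (real k * d)) + H (1 - of_real (real k * d))))"
          using pos[of "1 + real k * d"] pos[of "1 - real k * d"] c(2)[of k] \<open>k \<in> {..m}\<close>
          by (simp add: add_pos_pos)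
      qed auto
      then have \<Sigma>1: "\<Sigma> (\<lambda>z. h (z\<^sup>2)) 1 \<noteq> 0"
        using H0 by (auto simp: \<Sigma>h)
      show "uniform_limit K (\<lambda>n. \<Sigma> (\<lambda>z. poly (p n) (z\<^sup>2))) (\<Sigma> (\<lambda>z. h (z\<^sup>2))) sequentially"
        if "compact K" "K \<subseteq> ?S" for K
      proof -
        have ul: "uniform_limit K (\<lambda>n z. poly (p n) ((z + a)\<^sup>2)) (\<lambda>z. h ((z + a)\<^sup>2)) sequentially" for a
        proof -
          have "bounded ((\<lambda>z. (z + a)\<^sup>2) ` K)"
            by (intro compact_imp_bounded compact_continuous_image continuous_intros that)
          then obtain r where "(\<lambda>z. (z + a)\<^sup>2) ` K \<subseteq> ball 0 r"
            using bounded_subset_ballD[of "(\<lambda>z. (z + a)\<^sup>2) ` K" 0] by metis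
          then show ?thesis
            by (intro uniform_limit_compose'[OF p(3)[of r]] Pi_I)
              (metis image_subset_iff mem_ball mem_cball less_imp_le)
        qed
        show ?thesis unfolding \<Sigma>_def[abs_def]
          by (intro uniform_limit_sum bounded_linear.uniform_limit[OF bounded_linear_mult_right]
              uniform_limit_add ul ul[of "- a" for a, unfolded add_uminus_conv_diff])
      qed
      show "\<not> \<Sigma> (\<lambda>z. h (z\<^sup>2)) constant_on ?S"
        using \<Sigma>1 w w0 unfolding constant_on_def
        by (metis mem_Collect_eq one_complex.sel(1) zero_less_one)
    qed (use nz w in auto)
    then show ?thesis using H0 by (auto simp: \<Sigma>h)
  qed
  have "\<Sigma> H z = 0" "\<Sigma> H (- z) = 0" using z even[of z] by (auto simp: \<Sigma>_def)
  then have "\<not> Re z > 0" "\<not> Re (- z) > 0" using nonzero by blast+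
  then show ?thesis by simp
qed

section \<open>Bessel integrals\<close>

lemma has_field_derivative_integral:
  fixes F F' :: "complex \<Rightarrow> real \<Rightarrow> complex"
  assumes r: "r > 0"
    and der: "\<And>w t. w \<in> ball z r \<Longrightarrow> ((\<lambda>w. F w t) has_field_derivative F' w t) (at w)"
    and int: "\<And>w. w \<in> ball z r \<Longrightarrow> integrable lborel (F w)"
    and meas: "F' z \<in> borel_measurable lborel"
    and bound: "\<And>w t. w \<in> ball z r \<Longrightarrow> norm (F' w t) \<le> g t" and g: "integrable lborel g"
  shows "((\<lambda>w. LINT t|lborel. F w t) has_field_derivative (LINT t|lborel. F' z t)) (at z)"
proof -
  have z: "z \<in> ball z r" using r by simp
  have lip: "norm ((F w t - F z t) / (w - z)) \<le> g t" if "w \<in> ball z r" "w \<noteq> z" for w t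
  proof -
    \<comment> \<open>By the mean value inequality on the convex ball, the majorant of the
      derivative also dominates the difference quotients, as dominated convergence requires.\<close>
    have "norm (F w t - F z t) \<le> g t * norm (w - z)"
    proof (rule field_differentiable_bound[OF convex_ball _ bound that(1) z])
      show "((\<lambda>w. F w t) has_field_derivative F' x t) (at x within ball z r)" if "x \<in> ball z r" for x
        using der[OF that] by (rule has_field_derivative_at_within)
    qed
    then show ?thesis using that(2) by (simp add: norm_divide field_simps)
  qed
  show ?thesis
    unfolding has_field_derivative_iff tendsto_at_iff_sequentially
  proof (intro allI impI)
    fix X :: "nat \<Rightarrow> complex"
    assume Xne: "\<forall>i. X i \<in> UNIV - {z}" and X: "X \<longlonglongrightarrow> z"
    obtain N where N: "\<And>i. i \<ge> N \<Longrightarrow> X i \<in> ball z r"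
      using X r unfolding lim_sequentially by (metis dist_commute mem_ball)
    let ?Y = "\<lambda>i. X (i + N)"
    have Y: "?Y i \<in> ball z r" "?Y i \<noteq> z" for i using N Xne by auto
    have "(\<lambda>i. LINT t|lborel. (F (?Y i) t - F z t) / (?Y i - z)) \<longlonglongrightarrow> (LINT t|lborel. F' z t)"
    proof (rule integral_dominated_convergence[OF meas _ g])
      show "(\<lambda>t. (F (?Y i) t - F z t) / (?Y i - z)) \<in> borel_measurable lborel" for i
        using int[OF Y(1)] int[OF z] by (intro borel_measurable_divide borel_measurable_diff) auto
      show "AE t in lborel. (\<lambda>i. (F (?Y i) t - F z t) / (?Y i - z)) \<longlonglongrightarrow> F' z t"
      proof (rule AE_I2)
        fix t
        have "((\<lambda>w. (F w t - F z t) / (w - z)) \<longlongrightarrow> F' z t) (at z)"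
          using der[OF z] unfolding has_field_derivative_iff .
        moreover have "filterlim ?Y (at z) sequentially"
          using LIMSEQ_ignore_initial_segment[OF X] Y(2) by (auto simp: filterlim_at)
        ultimately show "(\<lambda>i. (F (?Y i) t - F z t) / (?Y i - z)) \<longlonglongrightarrow> F' z t"
          by (rule filterlim_compose)
      qed
      show "AE t in lborel. norm ((F (?Y i) t - F z t) / (?Y i - z)) \<le> g t" for i
        using lip[OF Y] by simp
    qed
    moreover have "(LINT t|lborel. (F (?Y i) t - F z t) / (?Y i - z))
      = ((LINT t|lborel. F (?Y i) t) - (LINT t|lborel. F z t)) / (?Y i - z)" for i
      using int[OF Y(1)] int[OF z] by simp
    ultimately have "(\<lambda>i. ((LINT t|lborel. F (?Y i) t) - (LINT t|lborel. F z t)) / (?Y i - z))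
      \<longlonglongrightarrow> (LINT t|lborel. F' z t)" by (simp only:)
    then show "((\<lambda>w. ((LINT t|lborel. F w t) - (LINT t|lborel. F z t)) / (w - z)) \<circ> X)
      \<longlonglongrightarrow> (LINT t|lborel. F' z t)"
      unfolding o_def by (rule LIMSEQ_offset)
  qed
qed

section \<open>Estimates for the Bessel integrand\<close>

lemma cosh_of_real: "cosh (of_real t :: complex) = of_real (cosh t)"
  and sinh_of_real: "sinh (of_real t :: complex) = of_real (sinh t)" for t :: real
  by (simp_all add: cosh_def sinh_def scaleR_conv_of_real exp_of_real flip: of_real_minus)

lemma cosh_le_exp_abs: "cosh t \<le> exp \<bar>t\<bar>" for t :: real
proof -
  have "exp t + exp (- t) \<le> exp \<bar>t\<bar> + exp \<bar>t\<bar>" by (intro add_mono) auto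
  then show ?thesis by (simp add: cosh_field_def)
qed

text \<open>The constant is \<open>2 * 4 ^ 4\<close>, from
  \<open>(1 + |t| / 4) ^ 4 \<le> exp |t| \<le> 2 * cosh t\<close>. Quartic growth suffices to beat
  any multiple of \<open>t\<^sup>2\<close> in the exponent.\<close>

lemma cosh_ge_power4: "t ^ 4 / 512 \<le> cosh t" for t :: real
proof -
  have "(\<bar>t\<bar> / 4) ^ 4 \<le> (1 + \<bar>t\<bar> / real 4) ^ 4" by (intro power_mono) auto
  also have "\<dots> \<le> exp \<bar>t\<bar>" by (rule exp_ge_one_plus_x_over_n_power_n) auto
  also have "\<dots> \<le> exp t + exp (- t)" by (auto simp: abs_if)
  also have "\<dots> = 2 * cosh t" by (simp add: cosh_field_def)
  finally show ?thesis by (simp add: power_divide)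
qed

text \<open>Completing the square in \<open>t\<^sup>2\<close>: the minimum of
  \<open>x * t ^ 4 / 512 - (c + 1) * t\<^sup>2\<close> over real values of \<open>t\<^sup>2\<close>
  is \<open>- 128 * (c + 1)\<^sup>2 / x\<close>.\<close>

lemma exp_square_minus_cosh_le:
  fixes x c t :: real
  assumes "x > 0"
  shows "exp (c * t\<^sup>2 - x * cosh t) \<le> exp (128 * (c + 1)\<^sup>2 / x) * exp (- t\<^sup>2)"
proof -
  have "0 \<le> x / 512 * (t\<^sup>2 - 256 * (c + 1) / x)\<^sup>2" using assms by simp
  also have "\<dots> = x * (t ^ 4 / 512) - (c + 1) * t\<^sup>2 + 128 * (c + 1)\<^sup>2 / x"
    using assms by (simp add: field_simps power2_eq_square power4_eq_xxxx)
  also have "x * (t ^ 4 / 512) \<le> x * cosh t"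
    using assms cosh_ge_power4 by (intro mult_left_mono) auto
  finally have "c * t\<^sup>2 - x * cosh t \<le> 128 * (c + 1)\<^sup>2 / x + - t\<^sup>2" by (simp add: algebra_simps)
  then show ?thesis by (simp flip: exp_add)
qed

lemma integrable_exp_square_minus_cosh:
  fixes x c :: real
  assumes "x > 0"
  shows "integrable lborel (\<lambda>t. exp (c * t\<^sup>2 - x * cosh t))"
proof (rule Bochner_Integration.integrable_bound)
  have "integrable lborel (\<lambda>t::real. exp (- t\<^sup>2))"
    using has_bochner_integral_even_function[OF gaussian_moment_0] by (auto simp: has_bochner_integral_iff)
  then show "integrable lborel (\<lambda>t::real. exp (128 * (c + 1)\<^sup>2 / x) * exp (- t\<^sup>2))" by simp
  show "(\<lambda>t. exp (c * t\<^sup>2 - x * cosh t)) \<in> borel_measurable lborel"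
    unfolding measurable_lborel2 by (intro borel_measurable_continuous_onI continuous_intros)
  show "AE t in lborel. norm (exp (c * t\<^sup>2 - x * cosh t)) \<le> norm (exp (128 * (c + 1)\<^sup>2 / x) * exp (- t\<^sup>2))"
    using exp_square_minus_cosh_le[OF assms] by auto
qed

text \<open>\<open>bessel_moment 0 \<nu> x = 2 K\<^sub>\<nu>(x)\<close>; the higher moments are, up to sign, its derivatives in \<open>x\<close>.\<close>

definition bessel_moment :: "nat \<Rightarrow> complex \<Rightarrow> complex \<Rightarrow> complex" where
  "bessel_moment k \<nu> x =
     (LINT t|lborel. of_real (cosh t ^ k) * exp (\<nu> * of_real t - x * of_real (cosh t)))"

text \<open>The factor \<open>exp (k * |t|)\<close> makes room for powers of \<open>cosh t\<close>
  or for \<open>t\<close> itself; linear exponents are absorbed by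
  \<open>C * |t| \<le> C\<^sup>2 + t\<^sup>2\<close>. The right-hand side involves
  \<open>\<nu>\<close> and \<open>x\<close> only through \<open>C\<close> and
  \<open>x\<^sub>0\<close>, so it is a common majorant near a point.\<close>

lemma norm_bessel_kernel_le:
  fixes t x\<^sub>0 C :: real
  assumes "x\<^sub>0 \<le> Re x" "real k + norm \<nu> \<le> C"
  shows "exp (real k * \<bar>t\<bar>) * norm (exp (\<nu> * of_real t - x * of_real (cosh t)))
    \<le> exp (C\<^sup>2) * exp (1 * t\<^sup>2 - x\<^sub>0 * cosh t)"
proof -
  have "Re \<nu> * t \<le> norm \<nu> * \<bar>t\<bar>"
    using abs_ge_self[of "Re \<nu> * t"] mult_right_mono[OF abs_Re_le_cmod[of \<nu>], of "\<bar>t\<bar>"]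
    by (simp add: abs_mult)
  moreover have "(real k + norm \<nu>) * \<bar>t\<bar> \<le> C * \<bar>t\<bar>"
    using assms(2) by (intro mult_right_mono) auto
  moreover have "C * \<bar>t\<bar> \<le> C\<^sup>2 + t\<^sup>2"
  proof -
    have "0 \<le> (C - \<bar>t\<bar>)\<^sup>2 + C\<^sup>2 + t\<^sup>2" by simp
    then show ?thesis by (simp add: power2_diff)
  qed
  moreover have "x\<^sub>0 * cosh t \<le> Re x * cosh t"
    using assms(1) by (intro mult_right_mono) auto
  ultimately have "real k * \<bar>t\<bar> + (Re \<nu> * t - Re x * cosh t) \<le> C\<^sup>2 + (1 * t\<^sup>2 - x\<^sub>0 * cosh t)"
    unfolding distrib_right mult_1 by linarith
  then show ?thesis by (simp add: norm_exp_eq_Re flip: exp_add)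
qed

lemma bessel_kernel_measurable [measurable]:
  "(\<lambda>t. of_real (cosh t ^ k) * exp (\<nu> * of_real t - x * of_real (cosh t)) :: complex) \<in> borel_measurable lborel"
  unfolding measurable_lborel2 by (intro borel_measurable_continuous_onI continuous_intros)

lemma norm_bessel_moment_kernel_le:
  assumes "x\<^sub>0 \<le> Re x" "real k + norm \<nu> \<le> C"
  shows "norm (of_real (cosh t ^ k) * exp (\<nu> * of_real t - x * of_real (cosh t)) :: complex)
    \<le> exp (C\<^sup>2) * exp (1 * t\<^sup>2 - x\<^sub>0 * cosh t)"
proof -
  have "cosh t ^ k \<le> exp \<bar>t\<bar> ^ k" using cosh_le_exp_abs by (intro power_mono) auto
  then have "cosh t ^ k \<le> exp (real k * \<bar>t\<bar>)" by (simp add: exp_of_nat_mult)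
  then show ?thesis
    by (intro order_trans[OF _ norm_bessel_kernel_le[OF assms]])
      (simp add: norm_mult norm_power mult_right_mono)
qed

lemma integrable_bessel_kernel:
  assumes "Re x > 0"
  shows "integrable lborel (\<lambda>t. of_real (cosh t ^ k) * exp (\<nu> * of_real t - x * of_real (cosh t)) :: complex)"
proof (rule Bochner_Integration.integrable_bound)
  show "integrable lborel (\<lambda>t. exp ((real k + norm \<nu>)\<^sup>2) * exp (1 * t\<^sup>2 - Re x * cosh t))"
    by (intro integrable_mult_right integrable_exp_square_minus_cosh assms)
  show "AE t in lborel. norm (of_real (cosh t ^ k) * exp (\<nu> * of_real t - x * of_real (cosh t)) :: complex)
    \<le> norm (exp ((real k + norm \<nu>)\<^sup>2) * exp (1 * t\<^sup>2 - Re x * cosh t))"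
    using norm_bessel_moment_kernel_le[of "Re x" x k \<nu> "real k + norm \<nu>"] by simp
qed measurable

lemma bessel_moment_has_derivative_arg:
  assumes "Re x > 0"
  shows "(bessel_moment k \<nu> has_field_derivative - bessel_moment (Suc k) \<nu> x) (at x)"
proof -
  \<comment> \<open>On the ball of half the distance to the imaginary axis the real part stays above
    \<open>Re x / 2\<close>, so a single integrable majorant serves.\<close>
  have Re: "Re w > Re x / 2" if "w \<in> ball x (Re x / 2)" for w
    using that abs_Re_le_cmod[of "x - w"] by (auto simp: dist_norm)
  have "((\<lambda>x. bessel_moment k \<nu> x) has_field_derivative
    (LINT t|lborel. - (of_real (cosh t ^ Suc k) * exp (\<nu> * of_real t - x * of_real (cosh t))))) (at x)"
    unfolding bessel_moment_def
  proof (rule has_field_derivative_integral[where r = "Re x / 2" and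
        F' = "\<lambda>x t. - (of_real (cosh t ^ Suc k) * exp (\<nu> * of_real t - x * of_real (cosh t)))"])
    show "integrable lborel (\<lambda>t. exp ((real (Suc k) + norm \<nu>)\<^sup>2) * exp (1 * t\<^sup>2 - (Re x / 2) * cosh t))"
      using assms by (intro integrable_mult_right integrable_exp_square_minus_cosh) simp
    fix w t assume w: "w \<in> ball x (Re x / 2)"
    show "norm (- (of_real (cosh t ^ Suc k) * exp (\<nu> * of_real t - w * of_real (cosh t))) :: complex)
      \<le> exp ((real (Suc k) + norm \<nu>)\<^sup>2) * exp (1 * t\<^sup>2 - (Re x / 2) * cosh t)"
      unfolding norm_minus_cancel using Re[OF w] by (intro norm_bessel_moment_kernel_le) auto
    show "((\<lambda>w. of_real (cosh t ^ k) * exp (\<nu> * of_real t - w * of_real (cosh t))) has_field_derivative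
      - (of_real (cosh t ^ Suc k) * exp (\<nu> * of_real t - w * of_real (cosh t)))) (at w)"
      by (auto intro!: derivative_eq_intros)
  next
    fix w assume "w \<in> ball x (Re x / 2)"
    then show "integrable lborel (\<lambda>t. of_real (cosh t ^ k) * exp (\<nu> * of_real t - w * of_real (cosh t)) :: complex)"
      using Re assms by (intro integrable_bessel_kernel) fastforce
  next
    show "(\<lambda>t. - (of_real (cosh t ^ Suc k) * exp (\<nu> * of_real t - x * of_real (cosh t))) :: complex)
      \<in> borel_measurable lborel"
      by (intro borel_measurable_uminus bessel_kernel_measurable)
  qed (use assms in simp)
  then show ?thesis
    unfolding bessel_moment_def[of "Suc k"] by (simp only: Bochner_Integration.integral_minus)
qed

lemma bessel_moment_holomorphic_order:
  assumes "Re x > 0"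
  shows "(\<lambda>\<nu>. bessel_moment 0 \<nu> x) holomorphic_on UNIV"
proof -
  have "((\<lambda>\<nu>. bessel_moment 0 \<nu> x) has_field_derivative
    (LINT t|lborel. of_real t * exp (\<nu> * of_real t - x * of_real (cosh t)))) (at \<nu>)" for \<nu>
    unfolding bessel_moment_def
  proof (rule has_field_derivative_integral[where r = 1 and
        F' = "\<lambda>\<nu> t. of_real t * exp (\<nu> * of_real t - x * of_real (cosh t))"])
    show "integrable lborel (\<lambda>t. exp ((real 1 + (norm \<nu> + 1))\<^sup>2) * exp (1 * t\<^sup>2 - Re x * cosh t))"
      using assms by (intro integrable_mult_right integrable_exp_square_minus_cosh) simp
    show "(\<lambda>t. of_real t * exp (\<nu> * of_real t - x * of_real (cosh t))) \<in> borel_measurable lborel"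
      unfolding measurable_lborel2 by (intro borel_measurable_continuous_onI continuous_intros)
    fix w t assume "w \<in> ball \<nu> 1"
    then have w: "norm w \<le> norm \<nu> + 1"
      using norm_triangle_ineq2[of w \<nu>] by (simp add: dist_norm norm_minus_commute)
    have "\<bar>t\<bar> \<le> exp (real 1 * \<bar>t\<bar>)" using exp_ge_add_one_self[of "\<bar>t\<bar>"] by (simp del: exp_ge_add_one_self)
    then have "norm (of_real t * exp (w * of_real t - x * of_real (cosh t)))
      \<le> exp (real 1 * \<bar>t\<bar>) * norm (exp (w * of_real t - x * of_real (cosh t)))"
      by (simp only: norm_mult norm_of_real) (intro mult_right_mono, auto)
    also have "\<dots> \<le> exp ((real 1 + (norm \<nu> + 1))\<^sup>2) * exp (1 * t\<^sup>2 - Re x * cosh t)"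
      using w by (intro norm_bessel_kernel_le) auto
    finally show "norm (of_real t * exp (w * of_real t - x * of_real (cosh t)))
      \<le> exp ((real 1 + (norm \<nu> + 1))\<^sup>2) * exp (1 * t\<^sup>2 - Re x * cosh t)" .
    show "((\<lambda>w. of_real (cosh t ^ 0) * exp (w * of_real t - x * of_real (cosh t))) has_field_derivative
      of_real t * exp (w * of_real t - x * of_real (cosh t))) (at w)"
      by (auto intro!: derivative_eq_intros)
  qed (use assms integrable_bessel_kernel[of x 0] in auto)
  then show ?thesis unfolding holomorphic_on_def field_differentiable_def
    using has_field_derivative_at_within by blast
qed

text \<open>This is the modified Bessel equation, since moments 1 and 2 are minus the first and plus
  the second derivative in \<open>x\<close>. The corresponding combination of integrands is the
  derivative in \<open>t\<close> of
  \<open>(- x * sinh t - \<nu>) * exp (\<nu> * t - x * cosh t)\<close>, which vanishes at both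
  ends.\<close>

lemma bessel_moment_ode:
  assumes "Re x > 0"
  shows "x\<^sup>2 * bessel_moment 2 \<nu> x - x * bessel_moment 1 \<nu> x = (x\<^sup>2 + \<nu>\<^sup>2) * bessel_moment 0 \<nu> x"
proof -
  let ?e = "\<lambda>t. exp (\<nu> * of_real t - x * of_real (cosh t))"
  define F where "F t = (- x * of_real (sinh t) - \<nu>) * ?e t" for t
  define f where "f t = x\<^sup>2 * (of_real (cosh t ^ 2) * ?e t) - x * (of_real (cosh t ^ 1) * ?e t)
    - (x\<^sup>2 + \<nu>\<^sup>2) * (of_real (cosh t ^ 0) * ?e t)" for t
  note int = integrable_bessel_kernel[OF assms, of _ \<nu>]
  have int_f: "integrable lborel f"
    unfolding f_def
    by (intro Bochner_Integration.integrable_diff integrable_mult_right int)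
  have der: "(F has_vector_derivative f t) (at t)" for t
  proof -
    have "((\<lambda>w. (- x * sinh w - \<nu>) * exp (\<nu> * w - x * cosh w)) has_field_derivative
      x\<^sup>2 * (cosh w ^ 2 * exp (\<nu> * w - x * cosh w)) - x * (cosh w ^ 1 * exp (\<nu> * w - x * cosh w))
      - (x\<^sup>2 + \<nu>\<^sup>2) * (cosh w ^ 0 * exp (\<nu> * w - x * cosh w))) (at w)" for w
    proof (rule DERIV_cong)
      show "((\<lambda>w. (- x * sinh w - \<nu>) * exp (\<nu> * w - x * cosh w)) has_field_derivative
        (- x * cosh w) * exp (\<nu> * w - x * cosh w)
        + (- x * sinh w - \<nu>) * (exp (\<nu> * w - x * cosh w) * (\<nu> - x * sinh w))) (at w)"
        by (auto intro!: derivative_eq_intros)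
    qed (unfold cosh_square_eq, simp add: power2_eq_square algebra_simps)
    from has_vector_derivative_real_field[OF this, of t UNIV]
    show ?thesis unfolding F_def[abs_def] f_def by (simp add: cosh_of_real sinh_of_real)
  qed
  obtain B where B: "\<And>t. norm (F t) \<le> B * exp (- t\<^sup>2)"
  proof
    fix t :: real
    let ?C = "1 + norm \<nu>" and ?D = "128 * (1 + 1)\<^sup>2 / Re x"
    have "cosh t + sinh t > 0" "cosh t - sinh t > 0" by (simp_all add: cosh_plus_sinh cosh_minus_sinh)
    then have "\<bar>sinh t\<bar> \<le> cosh t" by simp
    then have "\<bar>sinh t\<bar> \<le> exp (real 1 * \<bar>t\<bar>)" using cosh_le_exp_abs[of t] by simp
    then have "norm (- x * of_real (sinh t) - \<nu>) \<le> norm x * exp (real 1 * \<bar>t\<bar>) + norm \<nu> * exp (real 1 * \<bar>t\<bar>)"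
      by (intro order_trans[OF norm_triangle_ineq4] add_mono) (auto simp: norm_mult intro!: mult_left_mono mult_right_le_one_le simp: mult_le_cancel_left1)
    then have "norm (F t) \<le> (norm x + norm \<nu>) * (exp (real 1 * \<bar>t\<bar>) * norm (?e t))"
      unfolding F_def norm_mult by (metis (no_types, lifting) distrib_right mult.assoc mult_right_mono norm_ge_zero)
    also have "\<dots> \<le> (norm x + norm \<nu>) * (exp (?C\<^sup>2) * exp (1 * t\<^sup>2 - Re x * cosh t))"
      by (intro mult_left_mono norm_bessel_kernel_le) auto
    also have "\<dots> \<le> (norm x + norm \<nu>) * (exp (?C\<^sup>2) * (exp ?D * exp (- t\<^sup>2)))"
      by (intro mult_left_mono exp_square_minus_cosh_le assms) auto
    finally show "norm (F t) \<le> ((norm x + norm \<nu>) * (exp (?C\<^sup>2) * exp ?D)) * exp (- t\<^sup>2)"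
      by (simp add: mult.assoc)
  qed
  have lim: "(F \<longlongrightarrow> 0) net" if "((\<lambda>t. B * exp (- t\<^sup>2)) \<longlongrightarrow> 0) net" for net
    by (rule Lim_null_comparison[OF always_eventually that]) (simp add: B)
  have "(F \<longlongrightarrow> 0) at_top" "(F \<longlongrightarrow> 0) at_bot"
    by (rule lim, real_asymp)+
  note lim = this
  have "(LBINT t=-\<infinity>..\<infinity>. f t) = 0 - 0"
  proof (rule interval_integral_FTC_integrable[of _ _ F])
    show "isCont f t" for t unfolding f_def by (intro continuous_intros)
    show "set_integrable lborel (einterval (- \<infinity>) \<infinity>) f"
      using int_f by (simp add: set_integrable_def)
  qed (use der lim in \<open>auto simp: ereal_tendsto_simps\<close>)
  then have "(LINT t|lborel. f t) = 0"
    by (simp add: interval_lebesgue_integral_def set_lebesgue_integral_def)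
  also have "(LINT t|lborel. f t) = x\<^sup>2 * bessel_moment 2 \<nu> x - x * bessel_moment 1 \<nu> x
    - (x\<^sup>2 + \<nu>\<^sup>2) * bessel_moment 0 \<nu> x"
    unfolding f_def bessel_moment_def using int[of 2] int[of 1] int[of 0]
    by (simp only: Bochner_Integration.integral_diff integrable_mult_right Bochner_Integration.integrable_diff
        integral_mult_right_zero)
  finally show ?thesis by simp
qed

section \<open>Zeros of the Bessel function in its order\<close>

text \<open>Since \<open>cosh t \<ge> 1\<close>, raising the argument from 1 to \<open>r\<close>
  gains at least the factor \<open>exp (1 - r)\<close> in the integrand.\<close>

lemma norm_bessel_moment_le:
  assumes "r \<ge> 1"
  shows "norm (bessel_moment k \<nu> (of_real r))
    \<le> exp (1 - r) * (LINT t|lborel. norm (of_real (cosh t ^ k) * exp (\<nu> * of_real t - 1 * of_real (cosh t)) :: complex))"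
proof -
  have "norm (bessel_moment k \<nu> (of_real r))
    \<le> (LINT t|lborel. exp (1 - r) * norm (of_real (cosh t ^ k) * exp (\<nu> * of_real t - 1 * of_real (cosh t)) :: complex))"
    unfolding bessel_moment_def
  proof (rule Bochner_Integration.integral_norm_bound_integral)
    show "integrable lborel (\<lambda>t. of_real (cosh t ^ k) * exp (\<nu> * of_real t - of_real r * of_real (cosh t)) :: complex)"
      using assms by (intro integrable_bessel_kernel) simp
    show "integrable lborel (\<lambda>t. exp (1 - r) * norm (of_real (cosh t ^ k) * exp (\<nu> * of_real t - 1 * of_real (cosh t)) :: complex))"
      by (intro integrable_mult_right integrable_norm integrable_bessel_kernel) simp
    fix t :: real
    have "(r - 1) * 1 \<le> (r - 1) * cosh t" using assms by (intro mult_left_mono cosh_real_ge_1) auto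
    then have "Re \<nu> * t - r * cosh t \<le> (1 - r) + (Re \<nu> * t - 1 * cosh t)" by (simp add: algebra_simps)
    then have "exp (Re \<nu> * t - r * cosh t) \<le> exp (1 - r) * exp (Re \<nu> * t - 1 * cosh t)"
      by (simp flip: exp_add)
    then have "\<bar>cosh t ^ k\<bar> * exp (Re \<nu> * t - r * cosh t)
      \<le> \<bar>cosh t ^ k\<bar> * (exp (1 - r) * exp (Re \<nu> * t - 1 * cosh t))"
      by (intro mult_left_mono) auto
    then show "norm (of_real (cosh t ^ k) * exp (\<nu> * of_real t - of_real r * of_real (cosh t)))
      \<le> exp (1 - r) * norm (of_real (cosh t ^ k) * exp (\<nu> * of_real t - 1 * of_real (cosh t)) :: complex)"
      by (simp add: norm_mult norm_exp_eq_Re norm_power mult_ac)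
  qed
  then show ?thesis by simp
qed

text \<open>Laplace's method: for large argument the integral is dominated by small
  \<open>t\<close>, where \<open>Re (exp (\<nu> * t))\<close> is near 1. This excludes an
  identically vanishing Wronskian later on.\<close>

lemma bessel_moment_0_eventually_nonzero:
  "\<exists>R. \<forall>r>R. bessel_moment 0 \<nu> (of_real r) \<noteq> 0"
proof -
  let ?f = "\<lambda>t. Re (exp (\<nu> * of_real t))"
  have "continuous_on UNIV ?f" by (intro continuous_intros)
  then have "isCont ?f 0" by (simp add: continuous_on_eq_continuous_at)
  then obtain t\<^sub>0 where t0: "t\<^sub>0 > 0" "\<And>t. \<bar>t\<bar> < t\<^sub>0 \<Longrightarrow> \<bar>?f t - ?f 0\<bar> < 1 / 2"
    unfolding continuous_at_eps_delta dist_real_def by (metis half_gt_zero_iff zero_less_one diff_zero)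
  have f_half: "?f t \<ge> 1 / 2" if "\<bar>t\<bar> < t\<^sub>0" for t
  proof -
    have "?f 0 = 1" by simp
    with t0(2)[OF that] show ?thesis unfolding abs_diff_less_iff by linarith
  qed
  \<comment> \<open>\<open>{0..t\<^sub>1}\<close> supplies the main term, the integrand has
    nonnegative real part up to \<open>|t| = s\<close>, and beyond \<open>s\<close> the extra decay
    is used; hence \<open>t\<^sub>1 < s < t\<^sub>0\<close>.\<close>
  define t\<^sub>1 where "t\<^sub>1 = t\<^sub>0 / 2"
  define s where "s = 3 * t\<^sub>0 / 4"
  have ts: "0 < t\<^sub>1" "t\<^sub>1 < s" "s < t\<^sub>0" using t0(1) by (auto simp: t\<^sub>1_def s_def)
  define \<eta> where "\<eta> = cosh s - cosh t\<^sub>1"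
  have \<eta>: "\<eta> > 0" using ts cosh_real_strict_mono[of t\<^sub>1 s] by (simp add: \<eta>_def)
  let ?k = "\<lambda>t. norm (of_real (cosh t ^ 0) * exp (\<nu> * of_real t - 1 * of_real (cosh t)) :: complex)"
  define D where "D = (LINT t|lborel. ?k t)"
  have intk: "integrable lborel ?k" by (intro integrable_norm integrable_bessel_kernel) simp
  define A where "A = exp (- cosh t\<^sub>1) / 2"
  have A: "A > 0" by (simp add: A_def)
  \<comment> \<open>The argument is split as \<open>1 + y\<close>: the 1 keeps the integrals finite,
    and multiplying by \<open>exp (y * cosh s)\<close> bounds the tail by \<open>D\<close>
    independently of \<open>y\<close> while the main term grows like
    \<open>exp (y * \<eta>)\<close>.\<close>
  have key: "exp (y * cosh s) * Re (bessel_moment 0 \<nu> (of_real (1 + y))) \<ge> A * exp (y * \<eta>) * t\<^sub>1 - D" if "y > 0" for y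
  proof -
    let ?g = "\<lambda>t. of_real (cosh t ^ 0) * exp (\<nu> * of_real t - of_real (1 + y) * of_real (cosh t)) :: complex"
    have intg: "integrable lborel ?g" using that by (intro integrable_bessel_kernel) simp
    have ind: "integrable lborel (\<lambda>t. A * exp (y * \<eta>) * indicator {0..t\<^sub>1} t)"
      using ts by (intro integrable_mult_right integrable_real_indicator) auto
    have "A * exp (y * \<eta>) * t\<^sub>1 - D = (LINT t|lborel. A * exp (y * \<eta>) * indicator {0..t\<^sub>1} t - ?k t)"
      unfolding D_def using ts by (subst Bochner_Integration.integral_diff[OF ind intk]) (simp add: content_real)
    also have "\<dots> \<le> (LINT t|lborel. exp (y * cosh s) * Re (?g t))"
    proof (rule integral_mono)
      show "integrable lborel (\<lambda>t. A * exp (y * \<eta>) * indicator {0..t\<^sub>1} t - ?k t)"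
        by (intro Bochner_Integration.integrable_diff ind intk)
      show "integrable lborel (\<lambda>t. exp (y * cosh s) * Re (?g t))"
        by (intro integrable_mult_right integrable_Re intg)
      fix t :: real
      define q where "q = exp (y * (cosh s - cosh t))"
      have g: "exp (y * cosh s) * Re (?g t) = ?f t * exp (- cosh t) * q"
        by (simp add: q_def Re_exp Im_exp algebra_simps flip: exp_add)
      have k: "?k t = exp (Re \<nu> * t) * exp (- cosh t)"
        by (simp add: norm_exp_eq_Re flip: exp_add)
      have fk: "\<bar>?f t\<bar> * exp (- cosh t) \<le> ?k t"
        unfolding k using abs_Re_le_cmod[of "exp (\<nu> * of_real t)"]
        by (intro mult_right_mono) (auto simp: norm_exp_eq_Re)
      have k0: "0 \<le> ?k t" by (rule norm_ge_zero)
      consider "t \<in> {0..t\<^sub>1}" | "t \<notin> {0..t\<^sub>1}" "\<bar>t\<bar> \<le> s" | "t \<notin> {0..t\<^sub>1}" "\<bar>t\<bar> > s" by linarith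
      then show "A * exp (y * \<eta>) * indicator {0..t\<^sub>1} t - ?k t \<le> exp (y * cosh s) * Re (?g t)"
      proof cases
        case 1
        then have c: "cosh t \<le> cosh t\<^sub>1" by (simp add: cosh_real_nonneg_le_iff)
        have f0: "?f t \<ge> 0" using f_half[of t] 1 ts by auto
        have "q \<ge> exp (y * \<eta>)" unfolding q_def \<eta>_def using c that by simp
        moreover have "?f t * exp (- cosh t) \<ge> 1 / 2 * exp (- cosh t\<^sub>1)"
          using f_half[of t] 1 ts c by (intro mult_mono) auto
        ultimately have "(1 / 2 * exp (- cosh t\<^sub>1)) * exp (y * \<eta>) \<le> (?f t * exp (- cosh t)) * q"
          using f0 by (rule_tac mult_mono) auto
        then have "A * exp (y * \<eta>) \<le> exp (y * cosh s) * Re (?g t)" unfolding g A_def by simp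
        moreover have "indicator {0..t\<^sub>1} t = (1::real)" using 1 by simp
        ultimately show ?thesis using k0 by (simp only: mult_1_right)
      next
        case 2
        then have "?f t * exp (- cosh t) * q \<ge> 0" using f_half[of t] ts by (simp add: q_def)
        moreover have "indicator {0..t\<^sub>1} t = (0::real)" using 2 by simp
        ultimately show ?thesis unfolding g[symmetric] using k0 by (simp only: mult_zero_right)
      next
        case 3
        then have "cosh s \<le> cosh \<bar>t\<bar>" using ts by (subst cosh_real_nonneg_le_iff) auto
        then have "y * (cosh s - cosh t) \<le> 0" using that by (intro mult_nonneg_nonpos) auto
        then have q: "0 < q" "q \<le> 1" by (auto simp: q_def)
        have "- (exp (y * cosh s) * Re (?g t)) \<le> \<bar>?f t\<bar> * exp (- cosh t) * q"
          unfolding g using q by (auto simp: abs_if)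
        also have "\<dots> \<le> \<bar>?f t\<bar> * exp (- cosh t) * 1" using q by (intro mult_left_mono) auto
        also have "\<dots> \<le> ?k t" using fk by simp
        finally have "- ?k t \<le> exp (y * cosh s) * Re (?g t)" by linarith
        moreover have "indicator {0..t\<^sub>1} t = (0::real)" using 3 by simp
        ultimately show ?thesis by (simp only: mult_zero_right)
      qed
    qed
    also have "\<dots> = exp (y * cosh s) * Re (bessel_moment 0 \<nu> (of_real (1 + y)))"
      using intg unfolding bessel_moment_def by (simp only: integral_mult_right_zero integral_Re)
    finally show ?thesis .
  qed
  have "filterlim (\<lambda>y. A * exp (y * \<eta>) * t\<^sub>1 - D) at_top at_top"
    using A \<eta> ts(1) by real_asymp
  then have "eventually (\<lambda>y. A * exp (y * \<eta>) * t\<^sub>1 - D > 0) at_top"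
    by (rule filterlim_at_top_dense[THEN iffD1, rule_format])
  then obtain Y where Y: "\<And>y. y > Y \<Longrightarrow> A * exp (y * \<eta>) * t\<^sub>1 - D > 0"
    unfolding eventually_at_top_dense by blast
  have "bessel_moment 0 \<nu> (of_real r) \<noteq> 0" if "r > 1 + max 0 Y" for r
  proof
    assume zero: "bessel_moment 0 \<nu> (of_real r) = 0"
    have r: "1 + (r - 1) = r" by simp
    have "A * exp ((r - 1) * \<eta>) * t\<^sub>1 - D \<le> 0"
      using key[of "r - 1", unfolded r zero] that by simp
    moreover have "r - 1 > Y" using that by linarith
    ultimately show False using Y[of "r - 1"] by linarith
  qed
  then show ?thesis by blast
qed

lemma Re_bessel_moment_real_order_pos:
  fixes a \<sigma> :: real
  assumes "a > 0"
  shows "Re (bessel_moment 0 (of_real \<sigma>) (of_real a)) > 0"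
proof -
  let ?g = "\<lambda>t. of_real (cosh t ^ 0) * exp (of_real \<sigma> * of_real t - of_real a * of_real (cosh t)) :: complex"
  have intg: "integrable lborel ?g" using assms by (intro integrable_bessel_kernel) simp
  have g: "Re (?g t) = exp (\<sigma> * t - a * cosh t)" for t
    by (simp add: Re_exp)
  define c where "c = exp (- \<bar>\<sigma>\<bar> - a * cosh 1)"
  have "0 < c" by (simp add: c_def)
  also have "c = (LINT t|lborel. c * indicator {0..1::real} t)" by simp
  also have "\<dots> \<le> (LINT t|lborel. Re (?g t))"
  proof (rule integral_mono)
    show "integrable lborel (\<lambda>t::real. c * indicator {0..1} t)"
      by (intro integrable_mult_right integrable_real_indicator) auto
    show "integrable lborel (\<lambda>t. Re (?g t))" by (intro integrable_Re intg)
    fix t :: real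
    show "c * indicator {0..1} t \<le> Re (?g t)"
    proof (cases "t \<in> {0..1}")
      case True
      then have "\<bar>\<sigma>\<bar> * \<bar>t\<bar> \<le> \<bar>\<sigma>\<bar> * 1" by (intro mult_left_mono) auto
      moreover have "- (\<sigma> * t) \<le> \<bar>\<sigma>\<bar> * \<bar>t\<bar>" by (metis abs_ge_minus_self abs_mult)
      moreover have "a * cosh t \<le> a * cosh 1" using True assms by (simp add: cosh_real_nonneg_le_iff)
      ultimately show ?thesis unfolding g c_def using True by simp
    qed (unfold g, simp)
  qed
  also have "\<dots> = Re (bessel_moment 0 (of_real \<sigma>) (of_real a))"
    using intg unfolding bessel_moment_def by (simp only: integral_Re)
  finally show ?thesis .
qed

text \<open>\<open>K\<^sub>\<nu>\<close> is an eigenfunction, with eigenvalue \<open>\<nu>\<^sup>2\<close>, of a symmetric differential operator on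
  \<open>(a, \<infinity>)\<close>. If it vanishes at \<open>a\<close>, then \<open>W(x) = x Im (K\<^sub>\<nu>'(x) cnj (K\<^sub>\<nu>(x)))\<close> vanishes at both ends,
  whereas \<open>x W'(x) = Im (\<nu>\<^sup>2) \<bar>K\<^sub>\<nu>(x)\<bar>\<^sup>2\<close>.\<close>

lemma bessel_moment_0_zero_imp_imaginary:
  fixes a :: real
  assumes a: "a > 0" and zero: "bessel_moment 0 \<nu> (of_real a) = 0"
  shows "Re \<nu> = 0"
proof (rule ccontr)
  assume nz: "Re \<nu> \<noteq> 0"
  \<comment> \<open>For real order the moment is positive. With both parts of \<open>\<nu>\<close>
    nonzero, \<open>Im (\<nu>\<^sup>2)\<close> is nonzero and can be divided by.\<close>
  have "Im \<nu> \<noteq> 0"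
  proof
    assume "Im \<nu> = 0"
    then have "\<nu> = of_real (Re \<nu>)" by (simp add: complex_eq_iff)
    then show False using Re_bessel_moment_real_order_pos[OF a, of "Re \<nu>"] zero by simp
  qed
  define s where "s = Im (\<nu>\<^sup>2)"
  have s: "s \<noteq> 0" using nz \<open>Im \<nu> \<noteq> 0\<close> by (simp add: s_def Im_power2)
  define M where "M k r = bessel_moment k \<nu> (of_real r)" for k and r :: real
  \<comment> \<open>Here \<open>- M 1\<close> is the derivative of \<open>M 0\<close>. Dividing by
    \<open>s\<close> makes the derivative \<open>(norm (M 0 r))\<^sup>2 / r\<close>, nonnegative
    whatever the sign of \<open>s\<close>.\<close>
  define U where "U r = r * Im (- M 1 r * cnj (M 0 r)) / s" for r
  have M: "(M k has_vector_derivative - M (Suc k) r) (at r)" if "r > 0" for k r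
    unfolding M_def[abs_def]
    using bessel_moment_has_derivative_arg[of "of_real r" k \<nu>] that
    by (intro has_vector_derivative_real_field) simp
  have U': "(U has_real_derivative (norm (M 0 r))\<^sup>2 / r) (at r)" if r: "r > 0" for r
  proof -
    have "((\<lambda>r. - M 1 r * cnj (M 0 r)) has_vector_derivative
      (- M 1 r * cnj (- M 1 r) + M 2 r * cnj (M 0 r))) (at r)"
      using M[OF r, of 0] M[OF r, of 1]
      by (auto intro!: derivative_eq_intros bounded_linear.has_vector_derivative[OF bounded_linear_cnj] simp: numeral_2_eq_2)
    then have "((\<lambda>r. Im (- M 1 r * cnj (M 0 r))) has_real_derivative
      Im (- M 1 r * cnj (- M 1 r) + M 2 r * cnj (M 0 r))) (at r)"
      unfolding has_real_derivative_iff_has_vector_derivative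
      by (rule bounded_linear.has_vector_derivative[OF bounded_linear_Im])
    then have "(U has_real_derivative (1 * Im (- M 1 r * cnj (M 0 r))
      + Im (- M 1 r * cnj (- M 1 r) + M 2 r * cnj (M 0 r)) * r) / s) (at r)"
      unfolding U_def[abs_def] by (intro DERIV_cdivide DERIV_mult DERIV_ident)
    moreover have "(1 * Im (- M 1 r * cnj (M 0 r))
      + Im (- M 1 r * cnj (- M 1 r) + M 2 r * cnj (M 0 r)) * r) / s = (norm (M 0 r))\<^sup>2 / r"
    proof -
      have ode: "(of_real r)\<^sup>2 * M 2 r - of_real r * M 1 r = ((of_real r)\<^sup>2 + \<nu>\<^sup>2) * M 0 r"
        using bessel_moment_ode[of "of_real r" \<nu>] r by (simp add: M_def)
      have "r * (Im (- M 1 r * cnj (M 0 r)) + Im (- M 1 r * cnj (- M 1 r) + M 2 r * cnj (M 0 r)) * r)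
        = Im (((of_real r)\<^sup>2 * M 2 r - of_real r * M 1 r) * cnj (M 0 r))"
        by (simp add: algebra_simps power2_eq_square)
      also have "\<dots> = Im (((of_real r)\<^sup>2 + \<nu>\<^sup>2) * (M 0 r * cnj (M 0 r)))"
        unfolding ode by (simp only: mult.assoc)
      also have "\<dots> = s * (norm (M 0 r))\<^sup>2"
        unfolding complex_norm_square[symmetric] s_def by (simp flip: of_real_power)
      finally show ?thesis using r s by (simp add: field_simps)
    qed
    ultimately show ?thesis by simp
  qed
  have U_mono: "U x \<le> U y" if "0 < x" "x \<le> y" for x y
  proof (rule DERIV_nonneg_imp_nondecreasing[OF that(2)])
    fix r assume "x \<le> r" "r \<le> y"
    then have "r > 0" using that by linarith
    then show "\<exists>d. (U has_real_derivative d) (at r) \<and> 0 \<le> d" using U'[of r] by (intro exI conjI) auto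
  qed
  define C where "C k = (LINT t|lborel. norm (of_real (cosh t ^ k) * exp (\<nu> * of_real t - 1 * of_real (cosh t)) :: complex))" for k
  have U_bound: "norm (U r) \<le> r * (exp (1 - r) * C 1 * (exp (1 - r) * C 0)) / \<bar>s\<bar>" if "r \<ge> 1" for r
  proof -
    have "\<bar>Im (- M 1 r * cnj (M 0 r))\<bar> \<le> norm (M 1 r) * norm (M 0 r)"
      using abs_Im_le_cmod[of "- M 1 r * cnj (M 0 r)"] by (simp add: norm_mult)
    also have "\<dots> \<le> exp (1 - r) * C 1 * (exp (1 - r) * C 0)"
      unfolding M_def C_def
      by (intro mult_mono norm_bessel_moment_le[OF that]) (auto intro!: mult_nonneg_nonneg integral_nonneg)
    finally have "\<bar>r\<bar> * \<bar>Im (- M 1 r * cnj (M 0 r))\<bar> / \<bar>s\<bar> \<le> r * (exp (1 - r) * C 1 * (exp (1 - r) * C 0)) / \<bar>s\<bar>"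
      using that by (intro divide_right_mono mult_mono) auto
    then show ?thesis unfolding U_def by (simp only: real_norm_def abs_divide abs_mult)
  qed
  have "((\<lambda>r::real. r * exp (1 - r) * exp (1 - r)) \<longlongrightarrow> 0) at_top" by real_asymp
  from tendsto_mult_right_zero[OF this, of "C 1 * C 0 / \<bar>s\<bar>"]
  have "((\<lambda>r. r * (exp (1 - r) * C 1 * (exp (1 - r) * C 0)) / \<bar>s\<bar>) \<longlongrightarrow> 0) at_top"
    by (simp add: mult_ac)
  then have U_lim: "(U \<longlongrightarrow> 0) at_top"
    by (rule Lim_null_comparison[rotated]) (use U_bound in \<open>auto intro: eventually_at_top_linorderI[of 1]\<close>)
  obtain R where R: "\<And>r. r > R \<Longrightarrow> M 0 r \<noteq> 0"
    using bessel_moment_0_eventually_nonzero[of \<nu>] unfolding M_def by blast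
  \<comment> \<open>Monotonicity with value 0 at \<open>a\<close> and limit 0 still allows
    \<open>U = 0\<close>; a strict increase just after a point where \<open>M 0\<close> is nonzero
    gives the contradiction.\<close>
  define r where "r = max a R + 1"
  have r: "r > a" "r > R" "r > 0" using a by (auto simp: r_def)
  have "(norm (M 0 r))\<^sup>2 / r > 0" using R[OF r(2)] r(3) by simp
  from DERIV_pos_inc_right[OF U'[OF r(3)] this]
  obtain d where "d > 0" and d: "\<And>h. 0 < h \<Longrightarrow> h < d \<Longrightarrow> U r < U (r + h)" by blast
  define q where "q = r + d / 2"
  have "U a = 0" using zero by (simp add: U_def M_def)
  then have "U q > 0" using U_mono[of a r] d[of "d / 2"] \<open>d > 0\<close> r a by (simp add: q_def)
  moreover have "U q \<le> 0"
  proof (rule tendsto_lowerbound[OF U_lim])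
    show "\<forall>\<^sub>F x in at_top. U q \<le> U x"
      using U_mono[of q] r \<open>d > 0\<close> by (intro eventually_at_top_linorderI[of q]) (auto simp: q_def)
  qed simp
  ultimately show False by simp
qed

text \<open>Split \<open>norm \<nu> * |t| \<le> \<epsilon> * (norm \<nu>)\<^sup>2 + t\<^sup>2 / (4 *
  \<epsilon>)\<close>; the decay of \<open>exp (- a * cosh t)\<close> absorbs the second
  summand.\<close>

lemma bessel_moment_0_growth:
  fixes a \<epsilon> :: real
  assumes "a > 0" "\<epsilon> > 0"
  shows "\<exists>C. \<forall>\<nu>. norm (bessel_moment 0 \<nu> (of_real a)) \<le> exp (C + \<epsilon> * (norm \<nu>)\<^sup>2)"
proof -
  define C where "C = (LINT t|lborel. exp (1 / (4 * \<epsilon>) * t\<^sup>2 - a * cosh t))"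
  have "norm (bessel_moment 0 \<nu> (of_real a)) \<le> exp (C + \<epsilon> * (norm \<nu>)\<^sup>2)" for \<nu>
  proof -
    have "norm (bessel_moment 0 \<nu> (of_real a))
      \<le> (LINT t|lborel. exp (\<epsilon> * (norm \<nu>)\<^sup>2) * exp (1 / (4 * \<epsilon>) * t\<^sup>2 - a * cosh t))"
      unfolding bessel_moment_def
    proof (rule Bochner_Integration.integral_norm_bound_integral)
      show "integrable lborel (\<lambda>t. exp (\<epsilon> * (norm \<nu>)\<^sup>2) * exp (1 / (4 * \<epsilon>) * t\<^sup>2 - a * cosh t))"
        using assms by (intro integrable_mult_right integrable_exp_square_minus_cosh)
      fix t :: real
      have "0 \<le> (2 * \<epsilon> * norm \<nu> - \<bar>t\<bar>)\<^sup>2 / (4 * \<epsilon>)" using assms by simp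
      also have "\<dots> = \<epsilon> * (norm \<nu>)\<^sup>2 + 1 / (4 * \<epsilon>) * t\<^sup>2 - norm \<nu> * \<bar>t\<bar>"
        using assms by (simp add: power2_diff field_simps power2_eq_square)
      finally have "norm \<nu> * \<bar>t\<bar> \<le> \<epsilon> * (norm \<nu>)\<^sup>2 + 1 / (4 * \<epsilon>) * t\<^sup>2" by simp
      moreover have "Re \<nu> * t \<le> norm \<nu> * \<bar>t\<bar>"
        using abs_ge_self[of "Re \<nu> * t"] mult_right_mono[OF abs_Re_le_cmod[of \<nu>], of "\<bar>t\<bar>"]
        by (simp add: abs_mult)
      ultimately have "Re \<nu> * t - a * cosh t \<le> \<epsilon> * (norm \<nu>)\<^sup>2 + (1 / (4 * \<epsilon>) * t\<^sup>2 - a * cosh t)" by linarith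
      then have "exp (Re \<nu> * t - a * cosh t) \<le> exp (\<epsilon> * (norm \<nu>)\<^sup>2) * exp (1 / (4 * \<epsilon>) * t\<^sup>2 - a * cosh t)"
        by (simp flip: exp_add)
      then show "norm (of_real (cosh t ^ 0) * exp (\<nu> * of_real t - of_real a * of_real (cosh t)))
        \<le> exp (\<epsilon> * (norm \<nu>)\<^sup>2) * exp (1 / (4 * \<epsilon>) * t\<^sup>2 - a * cosh t)"
        by (simp add: norm_exp_eq_Re)
    qed (rule integrable_bessel_kernel, use assms in simp)
    also have "\<dots> = exp (\<epsilon> * (norm \<nu>)\<^sup>2) * C" by (simp add: C_def)
    also have "\<dots> \<le> exp (\<epsilon> * (norm \<nu>)\<^sup>2) * exp C"
      using exp_ge_add_one_self[of C] by (intro mult_left_mono) (linarith, simp)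
    finally show ?thesis by (simp add: exp_add mult.commute)
  qed
  then show ?thesis by blast
qed

section \<open>Whole-line moments and the half-line integral\<close>

lemma bessel_moment_0_uminus: "bessel_moment 0 (- \<nu>) x = bessel_moment 0 \<nu> x"
  unfolding bessel_moment_def by (subst lborel_integral_real_affine[where c = "-1" and t = 0]) auto

text \<open>The half-line integrand is even, and over the whole line its \<open>cosh\<close>
  averages the moments of orders \<open>\<nu>\<close> and \<open>- \<nu>\<close>, which
  coincide.\<close>

lemma bessel_K_eq_moment:
  fixes a :: real
  assumes "a > 0"
  shows "bessel_K \<nu> a = bessel_moment 0 \<nu> (of_real a) / 2"
proof -
  let ?g = "\<lambda>t. complex_of_real (exp (- a * cosh t)) * cosh (\<nu> * complex_of_real t)"
  let ?h = "\<lambda>\<nu> t. of_real (cosh t ^ 0) * exp (\<nu> * of_real t - of_real a * of_real (cosh t)) :: complex"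
  have int: "integrable lborel (?h \<nu>)" for \<nu> using assms by (intro integrable_bessel_kernel) simp
  have h: "?h \<nu> t = of_real (exp (- a * cosh t)) * exp (\<nu> * of_real t)" for \<nu> t
    by (simp add: mult_exp_exp flip: exp_of_real)
  have g: "?g t = (?h \<nu> t + ?h (- \<nu>) t) / 2" for t
    unfolding h cosh_field_def[of "\<nu> * of_real t"] by (simp add: distrib_left)
  have intg: "integrable lborel ?g" unfolding g
    by (intro integrable_divide Bochner_Integration.integrable_add int)
  have "(LINT t|lborel. ?g t) = (bessel_moment 0 \<nu> (of_real a) + bessel_moment 0 (- \<nu>) (of_real a)) / 2"
    unfolding g bessel_moment_def
    by (simp only: integral_divide_zero Bochner_Integration.integral_add[OF int int])
  also have "\<dots> = bessel_moment 0 \<nu> (of_real a)" by (simp add: bessel_moment_0_uminus)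
  finally have total: "(LINT t|lborel. ?g t) = bessel_moment 0 \<nu> (of_real a)" .
  have "integrable lborel (\<lambda>t. indicator {0..} t *\<^sub>R ?g t)"
    using intg by (intro integrable_mult_indicator) auto
  then have "has_bochner_integral lborel (\<lambda>t. indicator {0..} t *\<^sub>R ?g t) (bessel_K \<nu> a)"
    unfolding bessel_K_def set_lebesgue_integral_def by (rule has_bochner_integral_integrable)
  then have "has_bochner_integral lborel ?g (2 *\<^sub>R bessel_K \<nu> a)"
    by (rule has_bochner_integral_even_function) simp
  then have "(LINT t|lborel. ?g t) = 2 *\<^sub>R bessel_K \<nu> a" by (rule has_bochner_integral_integral_eq)
  then show ?thesis unfolding total by (simp add: scaleR_conv_of_real)
qed

section \<open>The theta kernel\<close>

lemma power4_le_exp: "x ^ 4 \<le> 256 * exp x" if "x \<ge> 0" for x :: real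
proof -
  have "(x / 4) ^ 4 \<le> (1 + x / real 4) ^ 4" using that by (intro power_mono) auto
  also have "\<dots> \<le> exp x" using that by (intro exp_ge_one_plus_x_over_n_power_n) auto
  finally show ?thesis by (simp add: power_divide)
qed

definition Phi_term :: "real \<Rightarrow> nat \<Rightarrow> real" where
  "Phi_term t j = (2 * pi ^ 2 * real (Suc j) ^ 4 * exp (9 * t / 4) - 3 * pi * real (Suc j) ^ 2 * exp (5 * t / 4))
    * exp (- pi * real (Suc j) ^ 2 * exp t)"

lemma Phi_eq: "Phi t = (\<Sum>j. Phi_term t j)"
  by (simp add: Phi_def Phi_term_def Let_def)

text \<open>For \<open>t \<ge> 0\<close> the positive part wins because \<open>3 < 2 * pi\<close>,
  \<open>n ^ 2 \<le> n ^ 4\<close> and \<open>exp (5 * t / 4) \<le> exp (9 * t / 4)\<close>.\<close>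

lemma Phi_term_bounds:
  assumes "t \<ge> 0"
  shows "0 \<le> Phi_term t j"
    and "Phi_term t j \<le> 2 * pi ^ 2 * real (Suc j) ^ 4 * exp (9 * t / 4) * exp (- pi * real (Suc j) ^ 2 * exp t)"
proof -
  let ?n = "real (Suc j)"
  have "3 * pi * ?n ^ 2 * exp (5 * t / 4) \<le> 2 * pi ^ 2 * ?n ^ 4 * exp (9 * t / 4)"
  proof -
    have "3 * (?n ^ 2 * 1) \<le> (2 * pi) * (?n ^ 2 * ?n ^ 2)"
      using pi_gt3 by (intro mult_mono) auto
    from mult_left_mono[OF this, of pi]
    have "pi * (3 * (?n ^ 2 * 1)) * exp (5 * t / 4) \<le> pi * ((2 * pi) * (?n ^ 2 * ?n ^ 2)) * exp (9 * t / 4)"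
      using assms by (rule_tac mult_mono) auto
    then show ?thesis by (simp add: power2_eq_square power4_eq_xxxx mult_ac del: of_nat_Suc)
  qed
  then show "0 \<le> Phi_term t j" by (simp add: Phi_term_def)
  show "Phi_term t j \<le> 2 * pi ^ 2 * real (Suc j) ^ 4 * exp (9 * t / 4) * exp (- pi * real (Suc j) ^ 2 * exp t)"
    unfolding Phi_term_def by (intro mult_right_mono) auto
qed

text \<open>Each term is at most a function of \<open>t\<close> decaying doubly exponentially, times
  a geometric sequence in \<open>j\<close>. With the decay of \<open>Phi_S\<close> this gives
  (A).\<close>

lemma tendsto_Phi_at_top: "(Phi \<longlongrightarrow> 0) at_top"
proof -
  let ?c = "\<lambda>t. 512 * pi ^ 2 * exp (9 * t / 4) * exp (- exp t)"
  let ?q = "\<lambda>j. exp (- 1 / 2) ^ j :: real"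
  have le: "Phi_term t j \<le> ?c t * ?q j" if "t \<ge> 0" for t j
  proof -
    define n where "n = real (Suc j)"
    have n: "n \<ge> 1" by (simp add: n_def)
    have "n * 1 \<le> n * n" using n by (intro mult_left_mono) auto
    then have n2: "n \<le> n ^ 2" by (simp add: power2_eq_square)
    \<comment> \<open>This turns the product \<open>n ^ 2 * exp t\<close> into a sum, so the
      exponential factors into a part in \<open>t\<close> and a part in \<open>n\<close>. Of the
      latter, \<open>exp n\<close> pays for \<open>n ^ 4\<close> and \<open>exp (- n / 2)\<close>
      remains.\<close>
    have "0 \<le> (n ^ 2 - 1) * (exp t - 1)" using that n2 n by (intro mult_nonneg_nonneg) auto
    then have prod: "n ^ 2 + exp t - 1 \<le> n ^ 2 * exp t" by (simp add: algebra_simps)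
    have "3 * (n ^ 2 * exp t) \<le> pi * (n ^ 2 * exp t)"
      using pi_gt3 by (intro mult_right_mono) auto
    then have "exp t + 3 / 2 * n \<le> pi * (n ^ 2 * exp t)"
      using prod n2 n one_le_exp_iff[of t, THEN iffD2, OF that] by linarith
    then have "exp (- pi * n ^ 2 * exp t) \<le> exp (- exp t + - 3 / 2 * n)"
      by (simp add: mult.assoc)
    also have "\<dots> = exp (- exp t) * exp (- 3 / 2 * n)" by (rule exp_add)
    finally have e: "exp (- pi * n ^ 2 * exp t) \<le> exp (- exp t) * exp (- 3 / 2 * n)" .
    have "Phi_term t j \<le> 2 * pi ^ 2 * n ^ 4 * exp (9 * t / 4) * exp (- pi * n ^ 2 * exp t)"
      unfolding n_def by (rule Phi_term_bounds[OF that])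
    also have "\<dots> \<le> 2 * pi ^ 2 * (256 * exp n) * exp (9 * t / 4) * (exp (- exp t) * exp (- 3 / 2 * n))"
      using e n power4_le_exp[of n] by (intro mult_mono mult_left_mono) auto
    also have "\<dots> = ?c t * (exp n * exp (- 3 / 2 * n))" by simp
    also have "exp n * exp (- 3 / 2 * n) = exp (real j * (- 1 / 2) + (- 1 / 2))"
      by (simp add: n_def field_simps flip: exp_add)
    also have "\<dots> \<le> ?q j" by (simp add: exp_of_nat_mult[symmetric])
    finally show ?thesis by (simp add: mult_left_mono)
  qed
  have sum_q: "summable ?q" by (intro summable_geometric) simp
  have bound: "norm (Phi t) \<le> ?c t * suminf ?q" if "t \<ge> 0" for t
  proof -
    have s: "summable (\<lambda>j. ?c t * ?q j)" by (intro summable_mult sum_q)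
    have nonneg: "0 \<le> Phi_term t j" for j by (rule Phi_term_bounds[OF that])
    have sP: "summable (Phi_term t)"
      by (rule summable_comparison_test'[OF s, of 0]) (use le[OF that] nonneg in auto)
    have "Phi t \<le> (\<Sum>j. ?c t * ?q j)" unfolding Phi_eq by (intro suminf_le le that sP s)
    also have "\<dots> = ?c t * suminf ?q" by (rule suminf_mult[OF sum_q])
    finally show ?thesis using suminf_nonneg[OF sP nonneg] by (simp add: Phi_eq)
  qed
  have "((\<lambda>t::real. exp (9 * t / 4) * exp (- exp t)) \<longlongrightarrow> 0) at_top" by real_asymp
  from tendsto_mult_right_zero[OF this, of "512 * pi ^ 2 * suminf ?q"]
  have "((\<lambda>t. ?c t * suminf ?q) \<longlongrightarrow> 0) at_top" by (simp add: mult_ac)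
  then show ?thesis
    by (rule Lim_null_comparison[rotated]) (use bound in \<open>auto intro: eventually_at_top_linorderI[of 0]\<close>)
qed

text \<open>Both come from decimal bounds on \<open>exp 1\<close> and
  \<open>exp pi = exp 3 * exp (pi - 3)\<close>; they are just sharp enough for the coarse bounds on
  \<open>beta_S\<close>.\<close>

lemma exp_pi_bounds: "20 \<le> exp pi" "exp pi \<le> 24"
proof -
  have e1: "2.718 \<le> exp (1::real)" "exp (1::real) \<le> 2.7183" using e_approx_32 by (simp_all add: abs_if split: if_split_asm)
  have e3: "exp (3::real) = exp 1 ^ 3" by (simp flip: exp_of_nat_mult)
  have "20 \<le> (2.718::real) ^ 3" by (simp add: power3_eq_cube)
  also have "\<dots> \<le> exp 3" unfolding e3 by (intro power_mono e1) auto
  also have "\<dots> \<le> exp pi" using pi_gt3 by simp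
  finally show "20 \<le> exp pi" .
  have "exp pi = exp 3 * exp (pi - 3)" by (simp flip: exp_add)
  also have "\<dots> \<le> 2.7183 ^ 3 * (1 + (pi - 3) + (pi - 3)\<^sup>2)"
    using pi_gt3 pi_approx unfolding e3
    by (intro mult_mono power_mono e1 exp_bound) auto
  also have "\<dots> \<le> 2.7183 ^ 3 * (1 + 0.1416 + 0.1416\<^sup>2)"
    using pi_gt3 pi_approx by (intro mult_left_mono add_mono power_mono) auto
  also have "\<dots> \<le> 24" by (simp add: power3_eq_cube power2_eq_square)
  finally show "exp pi \<le> 24" .
qed

text \<open>The claim is \<open>4 * pi ^ 2 < exp (2 * pi) * Phi 0 < 28 * pi ^ 2\<close>. The first
  term of the scaled series is \<open>(2 * pi ^ 2 - 3 * pi) * exp pi\<close>; the others are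
  nonnegative and bounded by a geometric tail.\<close>

lemma beta_S_bounds: "0 < beta_S" "beta_S < 6"
proof -
  let ?t = "Phi_term 0"
  define u where "u j = exp (2 * pi) * ?t j" for j
  have nonneg: "0 \<le> u j" for j using Phi_term_bounds(1)[of 0 j] by (simp add: u_def)
  \<comment> \<open>The ratio is \<open>6 / 20\<close>: for \<open>n = j + 1 \<ge> 2\<close>,
    \<open>n ^ 4 \<le> 6 ^ n\<close> and \<open>exp (2 * pi - pi * n ^ 2) \<le> exp (- pi * n) \<le>
    20 ^ (- n)\<close>.\<close>
  have u_le: "u j \<le> 2 * pi ^ 2 * ((3 / 10) ^ Suc j)" if "j \<ge> 1" for j
  proof -
    let ?n = "real (Suc j)"
    have n: "?n \<ge> 2" using that by simp
    have "?n \<le> ?n ^ 2 - 2"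
    proof -
      have "0 \<le> (?n - 2) * (?n + 1)" using n by (intro mult_nonneg_nonneg) auto
      then show ?thesis by (simp add: power2_eq_square algebra_simps)
    qed
    then have "pi * ?n \<le> pi * (?n ^ 2 - 2)" by (intro mult_left_mono) auto
    then have "2 * pi - pi * ?n ^ 2 \<le> - (?n * pi)" by (simp add: algebra_simps)
    then have "exp (2 * pi - pi * ?n ^ 2) \<le> exp (- (?n * pi))" by simp
    also have "\<dots> = inverse (exp pi ^ Suc j)" by (simp only: exp_minus exp_of_nat_mult)
    also have "\<dots> \<le> inverse (20 ^ Suc j)"
      using exp_pi_bounds by (intro le_imp_inverse_le power_mono) auto
    finally have e: "exp (2 * pi - pi * ?n ^ 2) \<le> (1 / 20) ^ Suc j"
      by (simp add: power_one_over inverse_eq_divide)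
    have p: "?n ^ 4 \<le> 6 ^ Suc j"
    proof (induction j)
      case (Suc j)
      show ?case
      proof (cases "j = 0")
        case False
        have "real (Suc (Suc j)) ^ 4 \<le> (3 / 2 * real (Suc j)) ^ 4"
          using False by (intro power_mono) auto
        also have "\<dots> = 81 / 16 * real (Suc j) ^ 4"
          by (simp only: power_mult_distrib) (simp add: power_divide)
        also have "\<dots> \<le> 6 * 6 ^ Suc j" using Suc by (intro mult_mono) auto
        finally show ?thesis by simp
      qed simp
    qed simp
    have "?t j \<le> 2 * pi ^ 2 * ?n ^ 4 * exp (- pi * ?n ^ 2)" using Phi_term_bounds(2)[of 0 j] by simp
    then have "u j \<le> exp (2 * pi) * (2 * pi ^ 2 * ?n ^ 4 * exp (- pi * ?n ^ 2))"
      unfolding u_def by (intro mult_left_mono) auto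
    also have "\<dots> = 2 * pi ^ 2 * (?n ^ 4 * exp (2 * pi - pi * ?n ^ 2))"
      by (simp add: exp_diff exp_minus field_simps)
    also have "\<dots> \<le> 2 * pi ^ 2 * (6 ^ Suc j * (1 / 20) ^ Suc j)"
      by (intro mult_left_mono mult_mono p e) auto
    also have "\<dots> = 2 * pi ^ 2 * ((3 / 10) ^ Suc j)" by (simp only: power_mult_distrib[symmetric]) simp
    finally show ?thesis .
  qed
  have geo: "(\<lambda>j. (3 / 10 :: real) ^ j) sums (10 / 7)" using geometric_sums[of "3 / 10 :: real"] by simp
  have g2: "(\<lambda>j. 2 * pi ^ 2 * ((3 / 10) ^ Suc (Suc j))) sums (9 / 35 * pi ^ 2)"
  proof -
    have "2 * pi ^ 2 * ((3 / 10) ^ Suc (Suc j)) = 2 * pi ^ 2 * 9 / 100 * (3 / 10) ^ j" for j by simp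
    moreover have "2 * pi ^ 2 * 9 / 100 * (10 / 7) = 9 / 35 * pi ^ 2" by simp
    ultimately show ?thesis using sums_mult[OF geo, of "2 * pi ^ 2 * 9 / 100"] by (simp only:)
  qed
  have su: "summable (\<lambda>j. u (Suc j))"
  proof (rule summable_comparison_test'[OF sums_summable[OF g2], of 0])
    show "norm (u (Suc j)) \<le> 2 * pi ^ 2 * ((3 / 10) ^ Suc (Suc j))" for j
      using u_le[of "Suc j"] nonneg[of "Suc j"] by (simp only: real_norm_def abs_of_nonneg)
  qed
  then have su0: "summable u" by (simp add: summable_Suc_iff)
  have "summable ?t"
    using su0 unfolding u_def by (simp add: summable_cmult_iff)
  then have "exp (2 * pi) * Phi 0 = suminf u"
    unfolding Phi_eq u_def by (simp add: suminf_mult)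
  also have "\<dots> = u 0 + (\<Sum>j. u (Suc j))" using suminf_split_head[OF su0] by simp
  finally have eq: "exp (2 * pi) * Phi 0 = u 0 + (\<Sum>j. u (Suc j))" .
  have "(\<Sum>j. u (Suc j)) \<le> (\<Sum>j. 2 * pi ^ 2 * ((3 / 10) ^ Suc (Suc j)))"
    by (intro suminf_le su sums_summable[OF g2] u_le) auto
  then have tail: "(\<Sum>j. u (Suc j)) \<le> 9 / 35 * pi ^ 2" using sums_unique[OF g2] by simp
  have tail0: "0 \<le> (\<Sum>j. u (Suc j))" using suminf_nonneg[OF su nonneg] .
  have u0: "u 0 = (2 * pi ^ 2 - 3 * pi) * exp pi"
  proof -
    have "exp (2 * pi) * exp (- pi) = exp pi" by (simp flip: exp_add)
    moreover have "u 0 = (2 * pi ^ 2 - 3 * pi) * (exp (2 * pi) * exp (- pi))"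
      by (simp add: u_def Phi_term_def)
    ultimately show ?thesis by simp
  qed
  have pos: "0 < 2 * pi - 3" using pi_gt3 by simp
  have lower: "u 0 > 4 * pi ^ 2"
  proof -
    have "pi * (4 * pi) < pi * ((2 * pi - 3) * 20)" using pi_gt3 by (intro mult_strict_left_mono) auto
    also have "\<dots> \<le> pi * ((2 * pi - 3) * exp pi)"
      using exp_pi_bounds pos by (intro mult_left_mono) auto
    finally show ?thesis unfolding u0 by (simp add: power2_eq_square algebra_simps)
  qed
  have upper: "u 0 + 9 / 35 * pi ^ 2 < 28 * pi ^ 2"
  proof -
    have "pi * ((2 * pi - 3) * exp pi) \<le> pi * ((2 * pi - 3) * 24)"
      using exp_pi_bounds pos by (intro mult_left_mono) auto
    also have "\<dots> < pi * ((28 - 9 / 35) * pi)" using pi_approx by (intro mult_strict_left_mono) auto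
    finally show ?thesis unfolding u0 by (simp add: power2_eq_square algebra_simps)
  qed
  show "0 < beta_S" unfolding beta_S_def using eq lower tail0 by (simp add: field_simps)
  show "beta_S < 6" unfolding beta_S_def using eq upper tail by (simp add: field_simps)
qed

section \<open>The approximating kernels\<close>

text \<open>The coefficients of the monic polynomial \<open>P\<close>. Index \<open>m\<close> stands
  for the separate summand \<open>cosh (9 * t / 4)\<close>, whose shift is
  \<open>m * (9 / (4 * m))\<close>.\<close>

definition shift_coeff :: "nat \<Rightarrow> real \<Rightarrow> nat \<Rightarrow> real" where
  "shift_coeff m b k = (if k = m then 1 else b * b_coeff m k)"

lemma f_S_eq:
  assumes "m > 0"
  shows "f_S m b t = (\<Sum>k\<le>m. shift_coeff m b k * cosh (real k * (9 / (4 * real m)) * t))"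
proof -
  have "(\<Sum>k\<le>m. shift_coeff m b k * cosh (real k * (9 / (4 * real m)) * t))
    = (\<Sum>k<m. shift_coeff m b k * cosh (real k * (9 / (4 * real m)) * t)) + cosh (9 * t / 4)"
    using assms by (simp add: lessThan_Suc_atMost[symmetric] shift_coeff_def)
  also have "(\<Sum>k<m. shift_coeff m b k * cosh (real k * (9 / (4 * real m)) * t))
    = b * (\<Sum>k<m. b_coeff m k * cosh (9 * real k * t / (4 * real m)))"
    by (simp add: shift_coeff_def sum_distrib_left mult_ac)
  finally show ?thesis by (simp add: f_S_def)
qed

text \<open>\<open>cosh (s * t) * exp (\<i> * z * t)\<close> is half the sum of the exponentials of
  orders \<open>\<i> * z + s\<close> and \<open>\<i> * z - s\<close>; the half turns
  \<open>4 * pi ^ 2\<close> into \<open>2 * pi ^ 2\<close>.\<close>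

lemma Xi_S_eq_moments:
  assumes "m > 0"
  shows "Xi_S m b (2 * z) = 2 * of_real pi ^ 2 * (\<Sum>k\<le>m. of_real (shift_coeff m b k) *
    (bessel_moment 0 (\<i> * z + of_real (real k * (9 / (4 * real m)))) (of_real (2 * pi))
     + bessel_moment 0 (\<i> * z - of_real (real k * (9 / (4 * real m)))) (of_real (2 * pi))))"
proof -
  let ?d = "9 / (4 * real m)"
  let ?h = "\<lambda>\<nu> t. of_real (cosh t ^ 0) * exp (\<nu> * of_real t - of_real (2 * pi) * of_real (cosh t)) :: complex"
  have int: "integrable lborel (?h \<nu>)" for \<nu> by (intro integrable_bessel_kernel) simp
  have h: "?h \<nu> t = of_real (exp (- 2 * pi * cosh t)) * exp (\<nu> * of_real t)" for \<nu> t
    by (simp add: mult_exp_exp flip: exp_of_real)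
  have cosh: "of_real (cosh (s * t)) * exp (\<i> * z * of_real t)
    = (exp ((\<i> * z + of_real s) * of_real t) + exp ((\<i> * z - of_real s) * of_real t)) / 2" for s t :: real
  proof -
    have "of_real (cosh (s * t)) = (exp (of_real s * of_real t) + exp (- (of_real s * of_real t)) :: complex) / 2"
      by (simp add: cosh_field_def flip: exp_of_real)
    moreover have "exp ((\<i> * z + of_real s) * of_real t) = exp (\<i> * z * of_real t) * exp (of_real s * of_real t)"
      "exp ((\<i> * z - of_real s) * of_real t) = exp (\<i> * z * of_real t) * exp (- (of_real s * of_real t))"
      by (simp_all add: algebra_simps flip: exp_add)
    ultimately show ?thesis by (simp only:) (simp add: algebra_simps)
  qed
  have pointwise: "complex_of_real (Phi_S m b t) * exp (\<i> * (2 * z / 2) * complex_of_real t)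
    = (\<Sum>k\<le>m. (2 * of_real pi ^ 2 * of_real (shift_coeff m b k)) * (?h (\<i> * z + of_real (real k * ?d)) t + ?h (\<i> * z - of_real (real k * ?d)) t))" for t
  proof -
    have "complex_of_real (Phi_S m b t) * exp (\<i> * (2 * z / 2) * complex_of_real t)
      = 4 * of_real pi ^ 2 * of_real (exp (- 2 * pi * cosh t)) *
        (\<Sum>k\<le>m. of_real (shift_coeff m b k) * (of_real (cosh (real k * ?d * t)) * exp (\<i> * z * of_real t)))"
      unfolding Phi_S_def f_S_eq[OF assms]
      by (simp add: sum_distrib_left sum_distrib_right mult_ac)
    also have "\<dots> = (\<Sum>k\<le>m. (2 * of_real pi ^ 2 * of_real (shift_coeff m b k)) *
      (?h (\<i> * z + of_real (real k * ?d)) t + ?h (\<i> * z - of_real (real k * ?d)) t))"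
      unfolding h cosh sum_distrib_left
      by (intro sum.cong refl) (simp add: algebra_simps)
    finally show ?thesis .
  qed
  have "Xi_S m b (2 * z) = (\<Sum>k\<le>m. LINT t|lborel. (2 * of_real pi ^ 2 * of_real (shift_coeff m b k)) *
      (?h (\<i> * z + of_real (real k * ?d)) t + ?h (\<i> * z - of_real (real k * ?d)) t))"
    unfolding Xi_S_def pointwise
    by (intro Bochner_Integration.integral_sum integrable_mult_right Bochner_Integration.integrable_add int)
  also have "\<dots> = (\<Sum>k\<le>m. (2 * of_real pi ^ 2 * of_real (shift_coeff m b k)) *
      (bessel_moment 0 (\<i> * z + of_real (real k * ?d)) (of_real (2 * pi))
      + bessel_moment 0 (\<i> * z - of_real (real k * ?d)) (of_real (2 * pi))))"
    unfolding bessel_moment_def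
    by (simp only: integral_mult_right_zero Bochner_Integration.integral_add[OF int int])
  finally show ?thesis by (simp only: sum_distrib_left mult.assoc)
qed

text \<open>For \<open>t \<ge> 0\<close> every hyperbolic cosine in \<open>f_S\<close> is at most
  \<open>cosh (9 * t / 4)\<close>, which the factor \<open>exp (- 2 * pi * cosh t)\<close>
  outweighs.\<close>

lemma tendsto_Phi_S_at_top: "(Phi_S m b \<longlongrightarrow> 0) at_top"
proof -
  let ?C = "4 * pi ^ 2 * (1 + \<bar>b\<bar> * (\<Sum>k<m. \<bar>b_coeff m k\<bar>))"
  have bound: "norm (Phi_S m b t) \<le> ?C * (cosh (9 * t / 4) * exp (- 2 * pi * cosh t))" if "t \<ge> 0" for t
  proof -
    have cosh: "cosh (9 * real k * t / (4 * real m)) \<le> cosh (9 * t / 4)" if "k < m" for k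
    proof -
      have "real k * (9 * t) \<le> real m * (9 * t)" using \<open>t \<ge> 0\<close> that by (intro mult_right_mono) auto
      then have "9 * real k * t / (4 * real m) \<le> 9 * t / 4" using that by (simp add: field_simps)
      then show ?thesis using \<open>t \<ge> 0\<close> by (subst cosh_real_nonneg_le_iff) auto
    qed
    have "\<bar>\<Sum>k<m. b_coeff m k * cosh (9 * real k * t / (4 * real m))\<bar> \<le> (\<Sum>k<m. \<bar>b_coeff m k\<bar> * cosh (9 * t / 4))"
      using cosh by (intro order_trans[OF sum_abs] sum_mono) (auto simp: abs_mult intro!: mult_left_mono)
    also have "\<dots> = (\<Sum>k<m. \<bar>b_coeff m k\<bar>) * cosh (9 * t / 4)" by (rule sum_distrib_right[symmetric])
    finally have "\<bar>b\<bar> * \<bar>\<Sum>k<m. b_coeff m k * cosh (9 * real k * t / (4 * real m))\<bar>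
      \<le> \<bar>b\<bar> * ((\<Sum>k<m. \<bar>b_coeff m k\<bar>) * cosh (9 * t / 4))" by (intro mult_left_mono) auto
    then have "\<bar>f_S m b t\<bar> \<le> cosh (9 * t / 4) + \<bar>b\<bar> * ((\<Sum>k<m. \<bar>b_coeff m k\<bar>) * cosh (9 * t / 4))"
      unfolding f_S_def by (intro order_trans[OF abs_triangle_ineq] add_mono) (auto simp: abs_mult)
    also have "\<dots> = (1 + \<bar>b\<bar> * (\<Sum>k<m. \<bar>b_coeff m k\<bar>)) * cosh (9 * t / 4)" by (simp add: algebra_simps)
    finally have "4 * pi ^ 2 * \<bar>f_S m b t\<bar> * exp (- 2 * pi * cosh t)
      \<le> 4 * pi ^ 2 * ((1 + \<bar>b\<bar> * (\<Sum>k<m. \<bar>b_coeff m k\<bar>)) * cosh (9 * t / 4)) * exp (- 2 * pi * cosh t)"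
      by (intro mult_right_mono mult_left_mono) auto
    then show ?thesis by (simp add: Phi_S_def abs_mult mult_ac)
  qed
  have lim: "((\<lambda>t::real. ?C * (cosh (9 * t / 4) * exp (- 2 * pi * cosh t))) \<longlongrightarrow> 0) at_top"
  proof (rule tendsto_mult_right_zero)
    show "((\<lambda>t::real. cosh (9 * t / 4) * exp (- 2 * pi * cosh t)) \<longlongrightarrow> 0) at_top"
      unfolding cosh_field_def using pi_gt_zero by real_asymp
  qed
  show ?thesis
    by (rule Lim_null_comparison[OF eventually_at_top_linorderI lim]) (rule bound)
qed

text \<open>This value makes \<open>b * m = 2 * beta_S\<close> equivalent to
  \<open>f_S m b 0 = 1 + beta_S\<close>, the normalisation behind (B).\<close>

lemma sum_b_coeff: "(\<Sum>k<m. b_coeff m k) = real m / 2"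
proof -
  have "(\<Sum>k<m. real k + 1) = real m * (real m + 1) / 2"
    by (induction m) (simp_all add: field_simps)
  moreover have "real m + 1 \<noteq> 0" by linarith
  ultimately show ?thesis
    unfolding b_coeff_def sum_divide_distrib[symmetric] by simp
qed

lemma Phi_S_0:
  assumes "b * real m = 2 * beta_S"
  shows "Phi_S m b 0 = Phi 0"
proof -
  have "f_S m b 0 = 1 + beta_S" using assms by (simp add: f_S_def sum_b_coeff)
  then show ?thesis by (simp add: Phi_S_def beta_S_def exp_minus field_simps)
qed

lemma bessel_moment_shift_sum_zeros:
  assumes m: "m \<ge> 11" and b: "b * real m = 2 * beta_S"
    and zero: "(\<Sum>k\<le>m. of_real (shift_coeff m b k) *
      (bessel_moment 0 (\<nu> + of_real (real k * (9 / (4 * real m)))) (of_real (2 * pi))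
       + bessel_moment 0 (\<nu> - of_real (real k * (9 / (4 * real m)))) (of_real (2 * pi)))) = 0"
  shows "Re \<nu> = 0"
proof -
  have b_pos: "b > 0" using b beta_S_bounds(1) m
    by (metis less_le_trans mult_pos_pos of_nat_0_less_iff zero_less_mult_pos2 zero_less_numeral)
  have b12: "b * real m < 12" using b beta_S_bounds(2) by simp
  \<comment> \<open>Consecutive coefficients have ratio
    \<open>(k + 1) / (k + 2) \<le> m / (m + 1)\<close>, except the last, which is
    \<open>b * m / (m + 1)\<close>. The latter is below 1 since
    \<open>b * m = 2 * beta_S < 12 \<le> m + 1\<close>: here \<open>m \<ge> 11\<close>
    enters.\<close>
  define \<rho> where "\<rho> = max (real m / (real m + 1)) (b * real m / (real m + 1))"
  have \<rho>: "0 \<le> \<rho>" "\<rho> < 1"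
    using m b12 by (auto simp: \<rho>_def le_max_iff_disj)
  show ?thesis
  proof (rule symmetric_shift_sum_entire_zeros[OF _ bessel_moment_0_uminus _ _ _ _ _ _ _ \<rho> _ zero])
    show "(\<lambda>\<nu>. bessel_moment 0 \<nu> (of_real (2 * pi))) holomorphic_on UNIV"
      by (intro bessel_moment_holomorphic_order) simp
    show "Re \<nu> = 0" if "bessel_moment 0 \<nu> (of_real (2 * pi)) = 0" for \<nu>
      using bessel_moment_0_zero_imp_imaginary[of "2 * pi" \<nu>] that by simp
    show "0 < Re (bessel_moment 0 (of_real \<sigma>) (of_real (2 * pi)))" for \<sigma>
      by (intro Re_bessel_moment_real_order_pos) simp
    show "\<exists>C. \<forall>\<nu>. norm (bessel_moment 0 \<nu> (of_real (2 * pi))) \<le> exp (C + \<epsilon> * (norm \<nu>)\<^sup>2)"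
      if "\<epsilon> > 0" for \<epsilon>
      using that by (intro bessel_moment_0_growth) auto
    show "0 < 9 / (4 * real m)" "0 < m" using m by auto
    show "shift_coeff m b m = 1" by (simp add: shift_coeff_def)
    show "0 < shift_coeff m b k" for k using b_pos by (simp add: shift_coeff_def b_coeff_def)
    show "shift_coeff m b k \<le> \<rho> * shift_coeff m b (Suc k)" if "k < m" for k
    proof (cases "Suc k = m")
      case True
      then have "real m = real k + 1" by simp
      then have "shift_coeff m b k = b * real m / (real m + 1)"
        using that by (simp add: shift_coeff_def b_coeff_def)
      then show ?thesis using True by (simp add: \<rho>_def shift_coeff_def)
    next
      case False
      have "real k + 1 \<le> real m / (real m + 1) * (real k + 2)"
      proof -
        have "(real k + 1) * (real m + 1) \<le> real m * (real k + 2)" using that by (simp add: algebra_simps)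
        then show ?thesis by (simp add: field_simps)
      qed
      also have "\<dots> \<le> \<rho> * (real k + 2)" unfolding \<rho>_def by (intro mult_right_mono) auto
      finally have "(real k + 1) * (b / (real m + 1)) \<le> \<rho> * (real k + 2) * (b / (real m + 1))"
        using b_pos by (intro mult_right_mono) auto
      then show ?thesis using that False by (simp add: shift_coeff_def b_coeff_def mult_ac add_ac)
    qed
  qed
qed

theorem theorem1:
  fixes m :: nat and b :: real
  assumes "m \<ge> 11"
    and "b * real m = 2 * beta_S"
  shows "(\<forall>z. Xi_S m b (2 * z) =
            4 * complex_of_real pi ^ 2 * (G (2 * pi) (\<i> * z + 9 / 4) + G (2 * pi) (\<i> * z - 9 / 4))
            + 4 * complex_of_real pi ^ 2 * complex_of_real b *
              (\<Sum>k<m. complex_of_real (b_coeff m k) *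
                 (G (2 * pi) (\<i> * z + 9 * of_nat k / (4 * of_nat m))
                  + G (2 * pi) (\<i> * z - 9 * of_nat k / (4 * of_nat m)))))
       \<and> ((\<lambda>t. Phi_S m b t - Phi t) \<longlongrightarrow> 0) at_top
       \<and> Phi_S m b 0 = Phi 0
       \<and> (\<lambda>z. Xi_S m b (2 * z)) holomorphic_on UNIV
       \<and> (\<forall>z. Xi_S m b (2 * z) = 0 \<longrightarrow> z \<in> \<real>)"
proof (intro conjI allI impI)
  have m: "m > 0" using assms(1) by simp
  note Xi = Xi_S_eq_moments[OF m, of b]
  show "((\<lambda>t. Phi_S m b t - Phi t) \<longlongrightarrow> 0) at_top"
    using tendsto_diff[OF tendsto_Phi_S_at_top tendsto_Phi_at_top] by simp
  show "Phi_S m b 0 = Phi 0" by (rule Phi_S_0[OF assms(2)])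
  have hol: "(\<lambda>z. bessel_moment 0 (\<i> * z + a) (of_real (2 * pi))) holomorphic_on UNIV" for a
    by (rule holomorphic_on_compose_gen[OF _ bessel_moment_holomorphic_order, unfolded o_def])
      (auto intro!: holomorphic_intros)
  show "(\<lambda>z. Xi_S m b (2 * z)) holomorphic_on UNIV"
    unfolding Xi by (intro holomorphic_intros hol hol[of "- a" for a, unfolded add_uminus_conv_diff])
  show "z \<in> \<real>" if "Xi_S m b (2 * z) = 0" for z
  proof -
    \<comment> \<open>\<open>Re (\<i> * z) = - Im z\<close>, so purely imaginary orders correspond
      to real \<open>z\<close>.\<close>
    have "Re (\<i> * z) = 0"
      using that unfolding Xi by (intro bessel_moment_shift_sum_zeros[OF assms]) simp
    then show ?thesis by (simp add: complex_is_Real_iff)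
  qed
  fix z
  let ?g = "\<lambda>k. G (2 * pi) (\<i> * z + 9 * of_nat k / (4 * of_nat m)) + G (2 * pi) (\<i> * z - 9 * of_nat k / (4 * of_nat m))"
  have M: "bessel_moment 0 \<nu> (of_real (2 * pi)) = 2 * G (2 * pi) \<nu>" for \<nu>
    by (simp add: G_def bessel_K_eq_moment)
  have d: "complex_of_real (real k * (9 / (4 * real m))) = 9 * of_nat k / (4 * of_nat m)" for k by simp
  have "Xi_S m b (2 * z) = 4 * of_real pi ^ 2 * (\<Sum>k\<le>m. of_real (shift_coeff m b k) * ?g k)"
    unfolding Xi M d by (simp add: sum_distrib_left algebra_simps)
  also have "(\<Sum>k\<le>m. of_real (shift_coeff m b k) * ?g k) = (\<Sum>k<m. of_real (shift_coeff m b k) * ?g k) + ?g m"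
    by (simp add: lessThan_Suc_atMost[symmetric] shift_coeff_def)
  also have "(\<Sum>k<m. of_real (shift_coeff m b k) * ?g k) = of_real b * (\<Sum>k<m. of_real (b_coeff m k) * ?g k)"
    by (simp add: shift_coeff_def sum_distrib_left mult.assoc)
  also have "?g m = G (2 * pi) (\<i> * z + 9 / 4) + G (2 * pi) (\<i> * z - 9 / 4)" using m by simp
  finally show "Xi_S m b (2 * z) =
            4 * complex_of_real pi ^ 2 * (G (2 * pi) (\<i> * z + 9 / 4) + G (2 * pi) (\<i> * z - 9 / 4))
            + 4 * complex_of_real pi ^ 2 * complex_of_real b *
              (\<Sum>k<m. complex_of_real (b_coeff m k) *
                 (G (2 * pi) (\<i> * z + 9 * of_nat k / (4 * of_nat m))
                  + G (2 * pi) (\<i> * z - 9 * of_nat k / (4 * of_nat m))))"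
    by (simp only: distrib_left mult.assoc add.commute)
qed

end
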